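(* The problem of deciding, given a graph $G$ and an integer $k$, whether $\mathbf{vsrc}(G)\le k$ is fixed-parameter tractable when parameterized by $k+t$, where $t-1$ is the treewidth of $G$; that is, it can be decided in time $f(k,t)\cdot |V(G)|^{O(1)}$ for some computable function $f$.
   Context: All graphs are finite, simple and undirected. A very strong rainbow coloring of $G$ is a coloring of $E(G)$ such that for every pair of vertices and every shortest path $P$ between them, all edges of $P$ receive pairwise different colors. $\mathbf{vsrc}(G)$ is the smallest number of colors in a very strong rainbow coloring of $G$. *)

theory Defs
  imports "HOL-Computational_Algebra.Polynomial"
begin

section \<open>Finite simple undirected graphs\<close>

definition simple_graph :: "'a set \<Rightarrow> 'a set set \<Rightarrow> bool" where
  "simple_graph V E \<longleftrightarrow> finite V \<and> (\<forall>e\<in>E. e \<subseteq> V \<and> card e = 2)"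

definition graph_path :: "'a set \<Rightarrow> 'a set set \<Rightarrow> 'a list \<Rightarrow> bool" where
  "graph_path V E p \<longleftrightarrow>
     p \<noteq> [] \<and> set p \<subseteq> V \<and> distinct p \<and> (\<forall>i. Suc i < length p \<longrightarrow> {p ! i, p ! Suc i} \<in> E)"

definition path_between :: "'a set \<Rightarrow> 'a set set \<Rightarrow> 'a \<Rightarrow> 'a \<Rightarrow> 'a list \<Rightarrow> bool" where
  "path_between V E u v p \<longleftrightarrow> graph_path V E p \<and> hd p = u \<and> last p = v"

definition shortest_path :: "'a set \<Rightarrow> 'a set set \<Rightarrow> 'a \<Rightarrow> 'a \<Rightarrow> 'a list \<Rightarrow> bool" where
  "shortest_path V E u v p \<longleftrightarrow>
     path_between V E u v p \<and> (\<forall>q. path_between V E u v q \<longrightarrow> length p \<le> length q)"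

definition path_edges :: "'a list \<Rightarrow> 'a set list" where
  "path_edges p = map (\<lambda>i. {p ! i, p ! Suc i}) [0..<length p - 1]"

definition very_strong_rainbow_coloring ::
    "'a set \<Rightarrow> 'a set set \<Rightarrow> ('a set \<Rightarrow> nat) \<Rightarrow> bool" where
  "very_strong_rainbow_coloring V E c \<longleftrightarrow>
     (\<forall>u\<in>V. \<forall>v\<in>V. \<forall>p. shortest_path V E u v p \<longrightarrow> distinct (map c (path_edges p)))"

definition vsrc :: "'a set \<Rightarrow> 'a set set \<Rightarrow> nat" where
  "vsrc V E = (LEAST m. \<exists>c. very_strong_rainbow_coloring V E c \<and> card (c ` E) = m)"


section \<open>Treewidth\<close>

definition connected_graph :: "'a set \<Rightarrow> 'a set set \<Rightarrow> bool" where
  "connected_graph V E \<longleftrightarrow> (\<forall>u\<in>V. \<forall>v\<in>V. \<exists>p. path_between V E u v p)"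

definition acyclic_graph :: "'a set \<Rightarrow> 'a set set \<Rightarrow> bool" where
  "acyclic_graph V E \<longleftrightarrow> \<not> (\<exists>p. graph_path V E p \<and> length p \<ge> 3 \<and> {last p, hd p} \<in> E)"

definition tree_graph :: "'a set \<Rightarrow> 'a set set \<Rightarrow> bool" where
  "tree_graph V E \<longleftrightarrow> simple_graph V E \<and> V \<noteq> {} \<and> connected_graph V E \<and> acyclic_graph V E"

definition tree_decomposition ::
    "'a set \<Rightarrow> 'a set set \<Rightarrow> nat set \<Rightarrow> nat set set \<Rightarrow> (nat \<Rightarrow> 'a set) \<Rightarrow> bool" where
  "tree_decomposition V E I F X \<longleftrightarrow>
     tree_graph I F \<and>
     (\<Union>i\<in>I. X i) = V \<and>
     (\<forall>e\<in>E. \<exists>i\<in>I. e \<subseteq> X i) \<and>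
     (\<forall>v\<in>V. connected_graph {i\<in>I. v \<in> X i} {e\<in>F. e \<subseteq> {i\<in>I. v \<in> X i}})"

definition decomposition_width :: "nat set \<Rightarrow> (nat \<Rightarrow> 'a set) \<Rightarrow> nat" where
  "decomposition_width I X = Max ((\<lambda>i. card (X i)) ` I) - 1"

text \<open>The truncated subtraction only matters for the graph without vertices, which gets
  treewidth 0 here instead of -1.\<close>

definition treewidth :: "'a set \<Rightarrow> 'a set set \<Rightarrow> nat" where
  "treewidth V E =
     (LEAST w. \<exists>I F X. tree_decomposition V E I F X \<and> decomposition_width I X = w)"


section \<open>Random access machine programs with running time\<close>

text \<open>Programs use registers and arrays of natural numbers, of which any given program mentions
  only finitely many. Every instruction and every test costs one time unit. Since there is no
  multiplication, a step lengthens the largest stored number by at most one bit (up to constants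
  occurring in the program), so unit-cost time is polynomially related to Turing machine time.
  Subtraction is truncated at 0.\<close>

record ram_state =
  reg :: "nat \<Rightarrow> nat"
  arr :: "nat \<Rightarrow> nat \<Rightarrow> nat"

datatype ram_prog =
    Const nat nat
  | Add nat nat nat
  | Sub nat nat nat
  | Load nat nat nat
  | Store nat nat nat
  | Seq ram_prog ram_prog
  | IfNZ nat ram_prog ram_prog
  | WhileNZ nat ram_prog

text \<open>\<open>ram_exec P s T s'\<close>: started in \<open>s\<close>, the program \<open>P\<close> halts after exactly \<open>T\<close> steps in \<open>s'\<close>.\<close>

inductive ram_exec :: "ram_prog \<Rightarrow> ram_state \<Rightarrow> nat \<Rightarrow> ram_state \<Rightarrow> bool" where
  Const: "ram_exec (Const x n) s 1 (s\<lparr>reg := (reg s)(x := n)\<rparr>)"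
| Add: "ram_exec (Add x y z) s 1 (s\<lparr>reg := (reg s)(x := reg s y + reg s z)\<rparr>)"
| Sub: "ram_exec (Sub x y z) s 1 (s\<lparr>reg := (reg s)(x := reg s y - reg s z)\<rparr>)"
| Load: "ram_exec (Load x a y) s 1 (s\<lparr>reg := (reg s)(x := arr s a (reg s y))\<rparr>)"
| Store: "ram_exec (Store a y x) s 1
            (s\<lparr>arr := (arr s)(a := (arr s a)(reg s y := reg s x))\<rparr>)"
| Seq: "ram_exec P s T1 s' \<Longrightarrow> ram_exec Q s' T2 s'' \<Longrightarrow> ram_exec (Seq P Q) s (T1 + T2) s''"
| IfTrue: "reg s x \<noteq> 0 \<Longrightarrow> ram_exec P s T s' \<Longrightarrow> ram_exec (IfNZ x P Q) s (T + 1) s'"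
| IfFalse: "reg s x = 0 \<Longrightarrow> ram_exec Q s T s' \<Longrightarrow> ram_exec (IfNZ x P Q) s (T + 1) s'"
| WhileFalse: "reg s x = 0 \<Longrightarrow> ram_exec (WhileNZ x P) s 1 s"
| WhileTrue: "reg s x \<noteq> 0 \<Longrightarrow> ram_exec P s T1 s' \<Longrightarrow> ram_exec (WhileNZ x P) s' T2 s'' \<Longrightarrow>
              ram_exec (WhileNZ x P) s (T1 + T2 + 1) s''"

definition nat_pair_input :: "nat \<Rightarrow> nat \<Rightarrow> ram_state" where
  "nat_pair_input a b = \<lparr>reg = (\<lambda>_. 0)(0 := a, 1 := b), arr = (\<lambda>_ _. 0)\<rparr>"

definition computable2 :: "(nat \<Rightarrow> nat \<Rightarrow> nat) \<Rightarrow> bool" where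
  "computable2 f \<longleftrightarrow>
     (\<exists>P. \<forall>a b. \<exists>T s'. ram_exec P (nat_pair_input a b) T s' \<and> reg s' 0 = f a b)"

text \<open>A graph on the vertices \<open>0, \<dots>, n - 1\<close> is presented by \<open>n\<close> in register 0 and its adjacency
  matrix, row by row, in array 0; the number \<open>k\<close> is in register 1.\<close>

definition graph_input :: "nat \<Rightarrow> nat set set \<Rightarrow> nat \<Rightarrow> ram_state" where
  "graph_input n E k =
     \<lparr>reg = (\<lambda>_. 0)(0 := n, 1 := k),
      arr = (\<lambda>a x. if a = 0 \<and> x < n * n \<and> {x div n, x mod n} \<in> E then 1 else 0)\<rparr>"

end

theory Submission
  imports Defs "HOL-Library.Nat_Bijection"
begin

text \<open>Two edges \<open>ab\<close> and \<open>a'b'\<close> lie on a common shortest path iff, up to orientation,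
  \<open>d(a,b') = d(b,a') + 2\<close>; so \<open>vsrc \<le> k\<close> asks for a proper \<open>k\<close>-colouring of this conflict graph,
  which can be decided separately for each connected component. If such a colouring exists, then
  every component has diameter at most \<open>k\<close>, and every neighbourhood is a union of \<open>k\<close> cliques,
  hence contains many edges. Both necessary conditions can be tested in polynomial time. On the
  other hand, treewidth \<open>t - 1\<close> makes every induced subgraph sparse, so a graph that passes the tests
  has maximum degree at most \<open>2kt\<close> and components with at most \<open>(2kt + 1)^k\<close> vertices, on which all
  colourings can be tried. The algorithm does not need to know \<open>t\<close>.

  The algorithm is written in a language of total expressions whose only loop is a bounded fold. Its
  compilation to the machine runs in time polynomial in a bound on all loop lengths, and \<open>f\<close> is
  itself computed by an expression of this language. Vertex sets and colourings are stored as the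
  bits of single numbers.\<close>

section \<open>Bounded loop expressions and their compilation\<close>

text \<open>Covering a neighbourhood by \<open>k\<close> cliques is colouring its complement, so
  this condition is not tested itself, only a count that follows from it. If a vertex has d
  neighbours in \<open>k\<close> colour classes, Cauchy-Schwarz gives d^2 \<le> k p, where p counts
  ordered pairs of equal or adjacent neighbours. Sparsity gives p \<le> 2 t d, and cancelling d
  leaves d \<le> 2 k t. The exponential search must not start on a graph that fails a test. Loop
  bounds therefore refer only to loops that are executed, and conjunction evaluates its second
  argument only if the first one holds. A single number B above all executed loop lengths then
  controls the time. It is a sum of \<open>n\<close> and a function of the parameters; since B + 1 =
  n + g \<le> (n + 1) g, a power of it splits into a polynomial in \<open>n\<close> and a function
  of \<open>k\<close> and \<open>t\<close>. Sets stored as numbers do no harm to loop lengths as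
  long as loops run over bit positions and never over the numbers themselves; only the search ranges
  over all numbers of a given bit length.\<close>

text \<open>\<open>ev A e xs ys\<close>: \<open>Var i\<close> is the de Bruijn index \<open>i\<close> into the environment \<open>xs\<close>. The loop
  \<open>Fold a b c\<close> pushes the accumulator and then the counter onto the environment of its body \<open>c\<close>, and
  \<open>Skip\<close> hides the accumulator again. \<open>Push\<close> collects arguments on the stack \<open>ys\<close>, which becomes
  the whole environment of a function body on \<open>Call\<close>; hence function bodies are never shifted.\<close>

datatype expr =
    Var nat
  | Num nat
  | Plus expr expr
  | Minus expr expr
  | Input expr
  | Ite expr expr expr
  | Fold expr expr expr
  | Skip expr
  | Push expr expr
  | Call expr

primrec iter :: "(nat \<Rightarrow> 'a \<Rightarrow> 'a) \<Rightarrow> 'a \<Rightarrow> nat \<Rightarrow> 'a" where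
  "iter f x 0 = x"
| "iter f x (Suc n) = f n (iter f x n)"

primrec ev :: "(nat \<Rightarrow> nat) \<Rightarrow> expr \<Rightarrow> nat list \<Rightarrow> nat list \<Rightarrow> nat" where
  "ev A (Var i) xs ys = (if i < length xs then xs ! i else 0)"
| "ev A (Num c) xs ys = c"
| "ev A (Plus a b) xs ys = ev A a xs [] + ev A b xs []"
| "ev A (Minus a b) xs ys = ev A a xs [] - ev A b xs []"
| "ev A (Input a) xs ys = A (ev A a xs [])"
| "ev A (Ite a b c) xs ys = (if ev A a xs [] \<noteq> 0 then ev A b xs [] else ev A c xs [])"
| "ev A (Fold a b c) xs ys =
     iter (\<lambda>i x. ev A c (i # x # xs) []) (ev A b xs []) (ev A a xs [])"
| "ev A (Skip a) xs ys = ev A a (take 1 xs @ drop 2 xs) []"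
| "ev A (Push a b) xs ys = ev A b xs (ev A a xs [] # ys)"
| "ev A (Call a) xs ys = ev A a ys []"

text \<open>An \<open>Ite\<close> is inspected only in the branch taken and a \<open>Fold\<close>
  body only in the states it really meets. This is what lets a cheap test guard an expensive
  loop.\<close>

primrec loops_le :: "nat \<Rightarrow> (nat \<Rightarrow> nat) \<Rightarrow> expr \<Rightarrow> nat list \<Rightarrow> nat list \<Rightarrow> bool" where
  "loops_le B A (Var i) xs ys = True"
| "loops_le B A (Num c) xs ys = True"
| "loops_le B A (Plus a b) xs ys = (loops_le B A a xs [] \<and> loops_le B A b xs [])"
| "loops_le B A (Minus a b) xs ys = (loops_le B A a xs [] \<and> loops_le B A b xs [])"
| "loops_le B A (Input a) xs ys = loops_le B A a xs []"
| "loops_le B A (Ite a b c) xs ys =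
     (loops_le B A a xs [] \<and>
      (if ev A a xs [] \<noteq> 0 then loops_le B A b xs [] else loops_le B A c xs []))"
| "loops_le B A (Fold a b c) xs ys =
     (loops_le B A a xs [] \<and> loops_le B A b xs [] \<and> ev A a xs [] \<le> B \<and>
      (\<forall>i<ev A a xs [].
         loops_le B A c (i # iter (\<lambda>i x. ev A c (i # x # xs) []) (ev A b xs []) i # xs) []))"
| "loops_le B A (Skip a) xs ys = loops_le B A a (take 1 xs @ drop 2 xs) []"
| "loops_le B A (Push a b) xs ys =
     (loops_le B A a xs [] \<and> loops_le B A b xs (ev A a xs [] # ys))"
| "loops_le B A (Call a) xs ys = loops_le B A a ys []"

lemma loops_le_mono: "loops_le B A e xs ys \<Longrightarrow> B \<le> B' \<Longrightarrow> loops_le B' A e xs ys"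
  by (induction e arbitrary: xs ys) (auto split: if_splits)

text \<open>A \<open>Fold\<close> runs its body finitely often, so the bounds of all rounds can be
  added up. Serves where only termination matters.\<close>

lemma ex_loops_le: "\<exists>B. loops_le B A e xs ys"
proof (induction e arbitrary: xs ys)
  case (Plus a b)
  obtain B C where "loops_le B A a xs []" "loops_le C A b xs []" using Plus by meson
  then have "loops_le (B + C) A (Plus a b) xs ys" by (auto intro: loops_le_mono)
  then show ?case by blast
next
  case (Minus a b)
  obtain B C where "loops_le B A a xs []" "loops_le C A b xs []" using Minus by meson
  then have "loops_le (B + C) A (Minus a b) xs ys" by (auto intro: loops_le_mono)
  then show ?case by blast
next
  case (Ite a b c)
  obtain B C D where "loops_le B A a xs []" "loops_le C A b xs []" "loops_le D A c xs []"
    using Ite by meson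
  then have "loops_le (B + C + D) A (Ite a b c) xs ys" by (auto intro: loops_le_mono)
  then show ?case by blast
next
  case (Fold a b c)
  obtain B C where 1: "loops_le B A a xs []" "loops_le C A b xs []" using Fold by meson
  define g where "g i = i # iter (\<lambda>i x. ev A c (i # x # xs) []) (ev A b xs []) i # xs" for i
  obtain D where D: "\<And>i. loops_le (D i) A c (g i) []" using Fold(3) by meson
  define N where "N = ev A a xs []"
  have "loops_le (B + C + N + (\<Sum>i<N. D i)) A c (g i) []" if "i < N" for i
    by (rule loops_le_mono[OF D]) (use that in \<open>auto intro!: trans_le_add2 member_le_sum\<close>)
  with 1 have "loops_le (B + C + N + (\<Sum>i<N. D i)) A (Fold a b c) xs ys"
    by (auto intro: loops_le_mono simp: N_def g_def)
  then show ?case by blast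
next
  case (Push a b)
  obtain B C where "loops_le B A a xs []" "loops_le C A b xs (ev A a xs [] # ys)"
    using Push by meson
  then have "loops_le (B + C) A (Push a b) xs ys" by (auto intro: loops_le_mono)
  then show ?case by blast
qed auto

section \<open>Compilation to register programs\<close>

definition move :: "nat \<Rightarrow> nat \<Rightarrow> ram_prog" where
  "move x y = Seq (Const x 0) (Add x x y)"

text \<open>The result lands in register \<open>d\<close>, scratch space lies at \<open>d\<close>
  and above, and \<open>rs\<close> and \<open>ss\<close> locate the environment and the stack below
  \<open>d\<close>. In a loop \<open>d\<close> counts the remaining rounds, because the machine only
  tests for zero; \<open>d+1\<close> is the accumulator and \<open>d+2\<close> the counter.\<close>

primrec compile :: "expr \<Rightarrow> nat \<Rightarrow> nat list \<Rightarrow> nat list \<Rightarrow> ram_prog" where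
  "compile (Var i) d rs ss = (if i < length rs then move d (rs ! i) else Const d 0)"
| "compile (Num c) d rs ss = Const d c"
| "compile (Plus a b) d rs ss = Seq (compile a d rs []) (Seq (compile b (d+1) rs []) (Add d d (d+1)))"
| "compile (Minus a b) d rs ss = Seq (compile a d rs []) (Seq (compile b (d+1) rs []) (Sub d d (d+1)))"
| "compile (Input a) d rs ss = Seq (compile a d rs []) (Load d 0 d)"
| "compile (Ite a b c) d rs ss = Seq (compile a d rs []) (IfNZ d (compile b d rs []) (compile c d rs []))"
| "compile (Fold a b c) d rs ss =
     Seq (compile a d rs []) (Seq (compile b (d+1) rs []) (Seq (Const (d+2) 0)
       (Seq
         (WhileNZ d
           (Seq (compile c (d+3) ((d+2) # (d+1) # rs) [])
             (Seq (move (d+1) (d+3)) (Seq (Const (d+3) 1) (Seq (Add (d+2) (d+2) (d+3))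
               (Sub d d (d+3)))))))
         (move d (d+1)))))"
| "compile (Skip a) d rs ss = compile a d (take 1 rs @ drop 2 rs) []"
| "compile (Push a b) d rs ss = Seq (compile a d rs []) (Seq (compile b (d+1) rs (d # ss)) (move d (d+1)))"
| "compile (Call a) d rs ss = compile a d ss []"

text \<open>In a round of a \<open>Fold\<close>, 6 is the loop test plus five instructions after the
  body. The final 4 is the initial counter, the failing test and the two steps of
  \<open>move\<close>.\<close>

primrec time_bound :: "nat \<Rightarrow> expr \<Rightarrow> nat" where
  "time_bound B (Var i) = 2"
| "time_bound B (Num c) = 1"
| "time_bound B (Plus a b) = time_bound B a + time_bound B b + 1"
| "time_bound B (Minus a b) = time_bound B a + time_bound B b + 1"
| "time_bound B (Input a) = time_bound B a + 1"
| "time_bound B (Ite a b c) = time_bound B a + time_bound B b + time_bound B c + 1"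
| "time_bound B (Fold a b c) = time_bound B a + time_bound B b + B * (time_bound B c + 6) + 4"
| "time_bound B (Skip a) = time_bound B a"
| "time_bound B (Push a b) = time_bound B a + time_bound B b + 2"
| "time_bound B (Call a) = time_bound B a"

section \<open>Polynomially bounded running time\<close>

definition poly_bounded :: "(nat \<Rightarrow> nat) \<Rightarrow> bool" where
  "poly_bounded g \<longleftrightarrow> (\<exists>K H. \<forall>B. g B \<le> K * (B + 1) ^ H)"

lemma poly_bounded_const: "poly_bounded (\<lambda>B. c)"
  unfolding poly_bounded_def by (rule exI[of _ c], rule exI[of _ 0]) simp

lemma poly_bounded_id: "poly_bounded (\<lambda>B. B)"
  unfolding poly_bounded_def by (rule exI[of _ 1], rule exI[of _ 1]) simp

lemma poly_bounded_add:
  assumes "poly_bounded f" "poly_bounded g"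
  shows "poly_bounded (\<lambda>B. f B + g B)"
proof -
  obtain K H K' H' where *: "\<And>B. f B \<le> K * (B + 1) ^ H" "\<And>B. g B \<le> K' * (B + 1) ^ H'"
    using assms unfolding poly_bounded_def by blast
  have "f B + g B \<le> (K + K') * (B + 1) ^ (H + H')" for B
  proof -
    have "K * (B + 1) ^ H \<le> K * (B + 1) ^ (H + H')" "K' * (B + 1) ^ H' \<le> K' * (B + 1) ^ (H + H')"
      by (intro mult_left_mono power_increasing; simp)+
    then show ?thesis using *[of B] unfolding add_mult_distrib by linarith
  qed
  then show ?thesis unfolding poly_bounded_def by blast
qed

lemma poly_bounded_mult:
  assumes "poly_bounded f" "poly_bounded g"
  shows "poly_bounded (\<lambda>B. f B * g B)"
proof -
  obtain K H K' H' where *: "\<And>B. f B \<le> K * (B + 1) ^ H" "\<And>B. g B \<le> K' * (B + 1) ^ H'"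
    using assms unfolding poly_bounded_def by blast
  have "f B * g B \<le> (K * K') * (B + 1) ^ (H + H')" for B
    using mult_mono[OF *(1)[of B] *(2)[of B]] by (simp add: power_add mult.assoc mult.left_commute)
  then show ?thesis unfolding poly_bounded_def by blast
qed

lemma poly_bounded_time_bound: "poly_bounded (\<lambda>B. time_bound B e)"
  by (induction e; unfold time_bound.simps)
     (assumption | rule poly_bounded_add poly_bounded_mult poly_bounded_const poly_bounded_id)+

lemma exec_Seq:
  "ram_exec P s T1 s' \<Longrightarrow> ram_exec Q s' T2 s'' \<Longrightarrow> T = T1 + T2 \<Longrightarrow> ram_exec (Seq P Q) s T s''"
  using ram_exec.Seq by blast

lemma exec_move:
  "x \<noteq> y \<Longrightarrow> ram_exec (move x y) s 2 (s\<lparr>reg := (reg s)(x := reg s y)\<rparr>)"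
  using exec_Seq[OF ram_exec.Const[of x 0 s] ram_exec.Add[of x x y] refl]
  unfolding move_def by (simp add: numeral_2_eq_2)

text \<open>Keeping all registers below \<open>d\<close> is the frame condition by which values
  computed earlier survive the evaluation of further subexpressions.\<close>

definition runs :: "ram_prog \<Rightarrow> ram_state \<Rightarrow> nat \<Rightarrow> nat \<Rightarrow> nat \<Rightarrow> bool" where
  "runs P s d v T \<longleftrightarrow> (\<exists>T' s'. ram_exec P s T' s' \<and> T' \<le> T \<and> reg s' d = v \<and>
     (\<forall>i<d. reg s' i = reg s i) \<and> arr s' = arr s)"

lemma runsE:
  assumes "runs P s d v T"
  obtains T' s' where "ram_exec P s T' s'" "T' \<le> T" "reg s' d = v"
    "\<And>i. i < d \<Longrightarrow> reg s' i = reg s i" "arr s' = arr s"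
  using assms unfolding runs_def by blast

lemma runsI:
  assumes "ram_exec P s T' s'" "T' \<le> T" "reg s' d = v"
    "\<And>i. i < d \<Longrightarrow> reg s' i = reg s i" "arr s' = arr s"
  shows "runs P s d v T"
  using assms unfolding runs_def by blast

theorem compile_correct:
  assumes "loops_le B (arr s 0) e (map (reg s) rs) (map (reg s) ss)"
    and "\<forall>r\<in>set rs. r < d" "\<forall>r\<in>set ss. r < d"
  shows "runs (compile e d rs ss) s d (ev (arr s 0) e (map (reg s) rs) (map (reg s) ss))
           (time_bound B e)"
  using assms
proof (induction e arbitrary: d rs ss s)
  case (Var i)
  show ?case
  proof (cases "i < length rs")
    case True
    then have "rs ! i < d" using Var(2) by simp
    then show ?thesis using True by (auto intro!: runsI[OF exec_move])
  qed (auto intro!: runsI[OF ram_exec.Const])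
next
  case (Num c)
  then show ?case by (auto intro!: runsI[OF ram_exec.Const])
next
  case (Plus a b)
  from Plus(3) have l: "loops_le B (arr s 0) a (map (reg s) rs) (map (reg s) [])"
     "loops_le B (arr s 0) b (map (reg s) rs) (map (reg s) [])" by auto
  obtain T1 s1 where 1: "ram_exec (compile a d rs []) s T1 s1" "T1 \<le> time_bound B a"
    "reg s1 d = ev (arr s 0) a (map (reg s) rs) []" "\<And>i. i < d \<Longrightarrow> reg s1 i = reg s i" "arr s1 = arr s"
    using Plus(1)[OF l(1), of d] Plus(4) by (auto elim: runsE)
  have m: "map (reg s1) rs = map (reg s) rs" using 1(4) Plus(4) by auto
  have r2: "runs (compile b (d+1) rs []) s1 (d+1) (ev (arr s 0) b (map (reg s) rs) []) (time_bound B b)"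
    using Plus(2)[of s1 rs "[]" "d+1"] l(2) Plus(4) m 1(5) by (auto simp: less_Suc_eq)
  obtain T2 s2 where 2: "ram_exec (compile b (d+1) rs []) s1 T2 s2" "T2 \<le> time_bound B b"
    "reg s2 (d+1) = ev (arr s 0) b (map (reg s) rs) []" "\<And>i. i < d+1 \<Longrightarrow> reg s2 i = reg s1 i"
    "arr s2 = arr s1"
    using r2 unfolding runs_def by blast
  show ?case unfolding compile.simps
    by (rule runsI, rule exec_Seq[OF 1(1) exec_Seq[OF 2(1) ram_exec.Add refl] refl])
       (use 1 2 in auto)
next
  case (Minus a b)
  from Minus(3) have l: "loops_le B (arr s 0) a (map (reg s) rs) (map (reg s) [])"
     "loops_le B (arr s 0) b (map (reg s) rs) (map (reg s) [])" by auto
  obtain T1 s1 where 1: "ram_exec (compile a d rs []) s T1 s1" "T1 \<le> time_bound B a"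
    "reg s1 d = ev (arr s 0) a (map (reg s) rs) []" "\<And>i. i < d \<Longrightarrow> reg s1 i = reg s i" "arr s1 = arr s"
    using Minus(1)[OF l(1), of d] Minus(4) by (auto elim: runsE)
  have m: "map (reg s1) rs = map (reg s) rs" using 1(4) Minus(4) by auto
  have r2: "runs (compile b (d+1) rs []) s1 (d+1) (ev (arr s 0) b (map (reg s) rs) []) (time_bound B b)"
    using Minus(2)[of s1 rs "[]" "d+1"] l(2) Minus(4) m 1(5) by (auto simp: less_Suc_eq)
  obtain T2 s2 where 2: "ram_exec (compile b (d+1) rs []) s1 T2 s2" "T2 \<le> time_bound B b"
    "reg s2 (d+1) = ev (arr s 0) b (map (reg s) rs) []" "\<And>i. i < d+1 \<Longrightarrow> reg s2 i = reg s1 i"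
    "arr s2 = arr s1"
    using r2 unfolding runs_def by blast
  show ?case unfolding compile.simps
    by (rule runsI, rule exec_Seq[OF 1(1) exec_Seq[OF 2(1) ram_exec.Sub refl] refl])
       (use 1 2 in auto)
next
  case (Input a)
  obtain T1 s1 where 1: "ram_exec (compile a d rs []) s T1 s1" "T1 \<le> time_bound B a"
    "reg s1 d = ev (arr s 0) a (map (reg s) rs) []" "\<And>i. i < d \<Longrightarrow> reg s1 i = reg s i" "arr s1 = arr s"
    using Input(1)[of s rs "[]" d] Input(2,3) by (auto elim: runsE)
  show ?case unfolding compile.simps
    by (rule runsI, rule exec_Seq[OF 1(1) ram_exec.Load refl]) (use 1 in auto)
next
  case (Ite a b c)
  obtain T1 s1 where 1: "ram_exec (compile a d rs []) s T1 s1" "T1 \<le> time_bound B a"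
    "reg s1 d = ev (arr s 0) a (map (reg s) rs) []" "\<And>i. i < d \<Longrightarrow> reg s1 i = reg s i" "arr s1 = arr s"
    using Ite(1)[of s rs "[]" d] Ite(4,5) by (auto elim: runsE)
  have m: "map (reg s1) rs = map (reg s) rs" using 1(4) Ite(5) by auto
  show ?case
  proof (cases "reg s1 d = 0")
    case True
    then have "runs (compile c d rs []) s1 d (ev (arr s 0) c (map (reg s) rs) []) (time_bound B c)"
      using Ite(3)[of s1 rs "[]" d] Ite(4,5) m 1(3,5) by auto
    then obtain T2 s2 where 2: "ram_exec (compile c d rs []) s1 T2 s2" "T2 \<le> time_bound B c"
      "reg s2 d = ev (arr s 0) c (map (reg s) rs) []" "\<And>i. i < d \<Longrightarrow> reg s2 i = reg s1 i"
      "arr s2 = arr s1"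
      unfolding runs_def by blast
    show ?thesis unfolding compile.simps
      by (rule runsI, rule exec_Seq[OF 1(1) ram_exec.IfFalse[OF True 2(1)] refl])
        (use True 1 2 in auto)
  next
    case False
    then have "runs (compile b d rs []) s1 d (ev (arr s 0) b (map (reg s) rs) []) (time_bound B b)"
      using Ite(2)[of s1 rs "[]" d] Ite(4,5) m 1(3,5) by auto
    then obtain T2 s2 where 2: "ram_exec (compile b d rs []) s1 T2 s2" "T2 \<le> time_bound B b"
      "reg s2 d = ev (arr s 0) b (map (reg s) rs) []" "\<And>i. i < d \<Longrightarrow> reg s2 i = reg s1 i"
      "arr s2 = arr s1"
      unfolding runs_def by blast
    show ?thesis unfolding compile.simps
      by (rule runsI, rule exec_Seq[OF 1(1) ram_exec.IfTrue[OF False 2(1)] refl])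
        (use False 1 2 in auto)
  qed
next
  case (Fold a b c)
  define xs where "xs = map (reg s) rs"
  define N where "N = ev (arr s 0) a xs []"
  define g where "g = (\<lambda>i x. ev (arr s 0) c (i # x # xs) [])"
  define x0 where "x0 = ev (arr s 0) b xs []"
  have l: "loops_le B (arr s 0) a xs []" "loops_le B (arr s 0) b xs []" "N \<le> B"
    "\<And>i. i < N \<Longrightarrow> loops_le B (arr s 0) c (i # iter g x0 i # xs) []"
    using Fold(4) by (auto simp: xs_def N_def g_def x0_def)
  obtain T1 s1 where 1: "ram_exec (compile a d rs []) s T1 s1" "T1 \<le> time_bound B a"
    "reg s1 d = N" "\<And>i. i < d \<Longrightarrow> reg s1 i = reg s i" "arr s1 = arr s"
    using Fold(1)[of s rs "[]" d] l(1) Fold(5) by (auto elim: runsE simp: xs_def N_def)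
  have m: "map (reg s1) rs = xs" using 1(4) Fold(5) by (auto simp: xs_def)
  have r2: "runs (compile b (d+1) rs []) s1 (d+1) x0 (time_bound B b)"
    using Fold(2)[of s1 rs "[]" "d+1"] l(2) Fold(5) m 1(5) by (auto simp: less_Suc_eq x0_def)
  obtain T2 s2 where 2: "ram_exec (compile b (d+1) rs []) s1 T2 s2" "T2 \<le> time_bound B b"
    "reg s2 (d+1) = x0" "\<And>i. i < d+1 \<Longrightarrow> reg s2 i = reg s1 i"
    "arr s2 = arr s1"
    using r2 unfolding runs_def by blast
  define body where "body = Seq (compile c (d+3) ((d+2) # (d+1) # rs) [])
             (Seq (move (d+1) (d+3)) (Seq (Const (d+3) 1) (Seq (Add (d+2) (d+2) (d+3))
               (Sub d d (d+3)))))"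
  \<comment> \<open>Induction on the number \<open>j\<close> of rounds left, the content of register
    \<open>d\<close>; \<open>N - j\<close> rounds are done.\<close>
  have loop: "\<exists>T s'. ram_exec (WhileNZ d body) s T s' \<and> T \<le> j * (time_bound B c + 6) + 1 \<and>
      reg s' (d+1) = iter g x0 N \<and> (\<forall>i<d. reg s' i = reg s i) \<and> arr s' = arr s"
    if "j \<le> N" "reg s d = j" "reg s (d+1) = iter g x0 (N - j)" "reg s (d+2) = N - j"
      "map (reg s) rs = xs" "arr s = arr s2" for j s
    using that
  proof (induction j arbitrary: s)
    case 0
    have "ram_exec (WhileNZ d body) s 1 s" by (rule ram_exec.WhileFalse) (use 0 in simp)
    then show ?case using 0 by (intro exI[of _ 1] exI[of _ s]) simp
  next
    case (Suc j)
    let ?i = "N - Suc j"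
    have A: "arr s 0 = arr s2 0" "arr s2 0 = arr s1 0" using Suc(7) 1(5) 2(5) by auto
    have l': "loops_le B (arr s 0) c (map (reg s) ((d+2) # (d+1) # rs)) (map (reg s) [])"
      using l(4)[of ?i] Suc(2-7) A 1(5) by simp
    have rs: "\<forall>r\<in>set ((d+2) # (d+1) # rs). r < d + 3" using Fold(5) by force
    obtain T3 s3 where 3: "ram_exec (compile c (d+3) ((d+2) # (d+1) # rs) []) s T3 s3"
      "T3 \<le> time_bound B c"
      "reg s3 (d+3) = ev (arr s 0) c (map (reg s) ((d+2) # (d+1) # rs)) []"
      "\<And>i. i < d+3 \<Longrightarrow> reg s3 i = reg s i" "arr s3 = arr s"
      using Fold(3)[OF l' rs] by (auto elim: runsE)
    have v: "reg s3 (d+3) = iter g x0 (Suc ?i)" unfolding 3(3)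
      using A 1(5) Suc(4-6) by (simp add: g_def)
    have i: "Suc ?i = N - j" using Suc(2) by simp
    \<comment> \<open>Register \<open>d+3\<close> serves twice: it delivers the value of the body
      and then holds the 1 for both counter updates.\<close>
    define s4 where "s4 = s3\<lparr>reg := (reg s3)(d+1 := reg s3 (d+3), d+3 := 1,
       d+2 := Suc (reg s (d+2)), d := reg s d - 1)\<rparr>"
    have "ram_exec (Seq (move (d+1) (d+3)) (Seq (Const (d+3) 1) (Seq (Add (d+2) (d+2) (d+3))
               (Sub d d (d+3))))) s3 5 s4"
      apply (rule exec_Seq[OF exec_move exec_Seq[OF ram_exec.Const
            exec_Seq[OF ram_exec.Add _ refl] refl]])
        apply simp
       prefer 2 apply simp
      subgoal
        using ram_exec.Sub[of d d "d+3" "s3\<lparr>reg := (reg s3)(d+1 := reg s3 (d+3), d+3 := 1,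
          d+2 := Suc (reg s3 (d+2)))\<rparr>"] 3(4)[of d] 3(4)[of "d+2"]
        by (simp add: s4_def)
      done
    then have e: "ram_exec body s (T3 + 5) s4"
      unfolding body_def by (rule exec_Seq[OF 3(1)]) simp
    have "\<exists>T s'. ram_exec (WhileNZ d body) s4 T s' \<and> T \<le> j * (time_bound B c + 6) + 1 \<and>
      reg s' (d+1) = iter g x0 N \<and> (\<forall>i<d. reg s' i = reg s4 i) \<and> arr s' = arr s4"
    proof (rule Suc.IH)
      show "map (reg s4) rs = xs" unfolding Suc(6)[symmetric] using Fold(5) 3(4)
        by (auto simp: s4_def)
    qed (use Suc(2-7) v i 3(4,5) in \<open>auto simp: s4_def\<close>)
    then obtain T s' where *: "ram_exec (WhileNZ d body) s4 T s'" "T \<le> j * (time_bound B c + 6) + 1"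
      "reg s' (d+1) = iter g x0 N" "\<forall>i<d. reg s' i = reg s4 i" "arr s' = arr s4" by blast
    have "ram_exec (WhileNZ d body) s ((T3 + 5) + T + 1) s'"
      by (rule ram_exec.WhileTrue[OF _ e *(1)]) (use Suc(3) in simp)
    moreover have "\<forall>i<d. reg s' i = reg s i" using *(4) 3(4) by (simp add: s4_def)
    ultimately show ?case using *(2,3,5) 3(2,5)
      by (intro exI[of _ "(T3 + 5) + T + 1"] exI[of _ s']) (simp add: s4_def)
  qed
  define s3 where "s3 = s2\<lparr>reg := (reg s2)(d+2 := 0)\<rparr>"
  have "\<exists>T s'. ram_exec (WhileNZ d body) s3 T s' \<and> T \<le> N * (time_bound B c + 6) + 1 \<and>
      reg s' (d+1) = iter g x0 N \<and> (\<forall>i<d. reg s' i = reg s3 i) \<and> arr s' = arr s3"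
  proof (rule loop)
    show "map (reg s3) rs = xs" unfolding m[symmetric] using Fold(5) 2(4)
        by (auto simp: s3_def)
  qed (use 1 2 in \<open>auto simp: s3_def\<close>)
  then obtain T s' where 3: "ram_exec (WhileNZ d body) s3 T s'" "T \<le> N * (time_bound B c + 6) + 1"
      "reg s' (d+1) = iter g x0 N" "\<forall>i<d. reg s' i = reg s3 i" "arr s' = arr s3" by blast
  have "N * (time_bound B c + 6) \<le> B * (time_bound B c + 6)" using l(3) by (rule mult_right_mono) simp
  then have T: "T1 + (T2 + (1 + (T + 2))) \<le> time_bound B (Fold a b c)" using 1(2) 2(2) 3(2)
    unfolding time_bound.simps by linarith
  have val: "iter g x0 N = ev (arr s 0) (Fold a b c) (map (reg s) rs) (map (reg s) ss)"
    by (simp add: g_def x0_def N_def xs_def)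
  have "d \<noteq> d + 1" by simp
  show ?case unfolding compile.simps body_def[symmetric]
    by (rule runsI, rule exec_Seq[OF 1(1) exec_Seq[OF 2(1) exec_Seq[OF ram_exec.Const
            exec_Seq[OF 3(1)[unfolded s3_def] exec_move[OF \<open>d \<noteq> d + 1\<close>] refl] refl] refl] refl], rule T)
       (use 1(4,5) 2(4,5) 3 val in \<open>auto simp: s3_def\<close>)
next
  case (Skip a)
  then show ?case
    using Skip.IH[of s "take 1 rs @ drop 2 rs" "[]" d]
    by (simp add: take_map drop_map) (meson UnE in_set_dropD in_set_takeD)
next
  case (Push a b)
  obtain T1 s1 where 1: "ram_exec (compile a d rs []) s T1 s1" "T1 \<le> time_bound B a"
    "reg s1 d = ev (arr s 0) a (map (reg s) rs) []" "\<And>i. i < d \<Longrightarrow> reg s1 i = reg s i" "arr s1 = arr s"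
    using Push(1)[of s rs "[]" d] Push(3,4) by (auto elim: runsE)
  have m: "map (reg s1) rs = map (reg s) rs" "map (reg s1) ss = map (reg s) ss"
    using 1(4) Push(4,5) by auto
  have r: "\<forall>r\<in>set rs. r < d + 1" "\<forall>r\<in>set (d # ss). r < d + 1" using Push(4,5) by auto
  have l: "loops_le B (arr s1 0) b (map (reg s1) rs) (map (reg s1) (d # ss))"
    using Push(3) unfolding list.map m 1(3,5) by simp
  obtain T2 s2 where 2: "ram_exec (compile b (d+1) rs (d # ss)) s1 T2 s2" "T2 \<le> time_bound B b"
    "reg s2 (d+1) = ev (arr s1 0) b (map (reg s1) rs) (map (reg s1) (d # ss))"
    "\<And>i. i < d+1 \<Longrightarrow> reg s2 i = reg s1 i" "arr s2 = arr s1"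
    using Push(2)[OF l r] by (auto elim: runsE)
  have "d \<noteq> d + 1" by simp
  show ?case unfolding compile.simps
    by (rule runsI, rule exec_Seq[OF 1(1) exec_Seq[OF 2(1) exec_move[OF \<open>d \<noteq> d + 1\<close>] refl] refl])
       (use 1 2 m in auto)
next
  case (Call a)
  then show ?case using Call.IH[of s ss "[]" d] by simp
qed


section \<open>Shortest paths and conflicting edges\<close>

text \<open>Cauchy-Schwarz against the constant vector, by summing 2ab \<le> a^2 + b^2 over all
  pairs of indices.\<close>

lemma sum_square_le: "(\<Sum>i<k. f i)\<^sup>2 \<le> k * (\<Sum>i<k. (f i)\<^sup>2)" for f :: "nat \<Rightarrow> nat"
proof -
  have *: "2 * (a * b) \<le> a\<^sup>2 + b\<^sup>2" for a b :: nat
  proof -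
    have "real (2 * (a * b)) \<le> real (a\<^sup>2 + b\<^sup>2)"
      using sum_squares_bound[of "real a" "real b"] by (simp add: mult.assoc)
    then show ?thesis by (simp only: of_nat_le_iff)
  qed
  have "2 * (\<Sum>i<k. f i)\<^sup>2 = (\<Sum>i<k. \<Sum>j<k. 2 * (f i * f j))"
    unfolding power2_eq_square sum_product by (simp only: sum_distrib_left)
  also have "\<dots> \<le> (\<Sum>i<k. \<Sum>j<k. (f i)\<^sup>2 + (f j)\<^sup>2)" by (intro sum_mono *)
  also have "\<dots> = 2 * (k * (\<Sum>i<k. (f i)\<^sup>2))"
    by (simp add: sum.distrib flip: sum_distrib_left)
  finally show ?thesis by simp
qed

text \<open>The monochromatic ordered pairs split into the squares of the \<open>k\<close> colour
  classes, whose sizes add up to \<open>card N\<close>.\<close>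

lemma card_square_le_card_monochromatic:
  assumes "finite N" and f: "\<And>u. u \<in> N \<Longrightarrow> f u < (k::nat)"
  shows "(card N)\<^sup>2 \<le> k * card {(u, w). u \<in> N \<and> w \<in> N \<and> f u = f w}"
proof -
  define C where "C i = {u \<in> N. f u = i}" for i
  have fin: "finite (C i)" for i using assms(1) by (simp add: C_def)
  have "N = (\<Union>i<k. C i)" using f by (auto simp: C_def)
  then have "card N = (\<Sum>i<k. card (C i))"
    using card_UN_disjoint[of "{..<k}" C] fin by (auto simp: C_def)
  moreover have "{(u, w). u \<in> N \<and> w \<in> N \<and> f u = f w} = (\<Union>i<k. C i \<times> C i)"
    using f by (auto simp: C_def)
  then have "card {(u, w). u \<in> N \<and> w \<in> N \<and> f u = f w} = (\<Sum>i<k. (card (C i))\<^sup>2)"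
    using card_UN_disjoint[of "{..<k}" "\<lambda>i. C i \<times> C i"] fin
    by (auto simp: C_def card_cartesian_product power2_eq_square)
  ultimately show ?thesis using sum_square_le by simp
qed

locale ugraph =
  fixes n :: nat and E :: "nat set set"
  assumes simple: "simple_graph {..<n} E"
begin

lemma edge_in: "{a, b} \<in> E \<Longrightarrow> a < n \<and> b < n \<and> a \<noteq> b"
proof -
  assume "{a, b} \<in> E"
  then have "{a, b} \<subseteq> {..<n}" "card {a, b} = 2" using simple unfolding simple_graph_def by auto
  then show ?thesis by (cases "a = b") auto
qed

lemma edgeE:
  assumes "e \<in> E"
  obtains a b where "e = {a, b}" "a < b" "b < n"
proof -
  have "card e = 2" using assms simple unfolding simple_graph_def by auto
  then obtain a b where "e = {a, b}" "a \<noteq> b" by (auto simp: card_2_iff)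
  then show thesis using that[of a b] that[of b a] edge_in[of a b] assms
    by (cases "a < b") (auto simp: insert_commute)
qed

lemma finite_edges: "finite E"
  by (rule finite_subset[of _ "Pow {..<n}"]) (use simple in \<open>auto simp: simple_graph_def\<close>)

section \<open>Balls, distances and connectedness\<close>

primrec ball :: "nat \<Rightarrow> nat \<Rightarrow> nat set" where
  "ball u 0 = {u}"
| "ball u (Suc l) = {v. v < n \<and> (\<exists>w<n. w \<in> ball u l \<and> (w = v \<or> {w, v} \<in> E))}"

text \<open>Balls grow with the radius, so for \<open>u < n\<close> the number of radii below
  \<open>n\<close> that miss \<open>v\<close> is the distance, or \<open>n\<close> if there is no
  path. Thus \<open>gdist u v < n\<close> expresses connectedness, and the distance is a bounded sum
  that an expression can evaluate.\<close>

definition gdist :: "nat \<Rightarrow> nat \<Rightarrow> nat" where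
  "gdist u v = card {l. l < n \<and> v \<notin> ball u l}"

lemma ball_less: "u < n \<Longrightarrow> v \<in> ball u l \<Longrightarrow> v < n"
  by (cases l) auto

lemma ball_Suc: "u < n \<Longrightarrow> v \<in> ball u l \<Longrightarrow> v \<in> ball u (Suc l)"
  using ball_less by auto

lemma ball_step: "u < n \<Longrightarrow> w \<in> ball u l \<Longrightarrow> {w, v} \<in> E \<Longrightarrow> v \<in> ball u (Suc l)"
  using edge_in[of w v] by auto

lemma ball_mono: "u < n \<Longrightarrow> v \<in> ball u l \<Longrightarrow> l \<le> l' \<Longrightarrow> v \<in> ball u l'"
proof (induction l')
  case (Suc l')
  then show ?case using ball_Suc[of u v l'] by (cases "l = Suc l'") (simp_all del: ball.simps)
qed simp

lemma ball_trans: "u < n \<Longrightarrow> w \<in> ball u l \<Longrightarrow> v \<in> ball w l' \<Longrightarrow> v \<in> ball u (l + l')"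
proof (induction l' arbitrary: v)
  case (Suc l')
  then obtain x where "v < n" "x < n" "x \<in> ball w l'" "x = v \<or> {x, v} \<in> E" by auto
  then show ?case using Suc(1)[of x] Suc(2,3) by auto
qed simp

lemma ball_sym: "u < n \<Longrightarrow> v \<in> ball u l \<Longrightarrow> u \<in> ball v l"
proof (induction l arbitrary: v)
  case (Suc l)
  from Suc(3) obtain w where w: "w \<in> ball u l" "w = v \<or> {w, v} \<in> E" "v < n" "w < n" by auto
  have "u \<in> ball w l" using Suc w by auto
  moreover have "w \<in> ball v 1" using w by (auto simp: insert_commute)
  ultimately show ?case using ball_trans[of v w 1 u l] w by simp
qed simp

lemma gdist_le_iff:
  assumes "u < n" "l < n"
  shows "gdist u v \<le> l \<longleftrightarrow> v \<in> ball u l"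
proof
  assume "v \<in> ball u l"
  then have "l' < l" if "v \<notin> ball u l'" for l'
    using ball_mono[OF assms(1)] that not_le_imp_less by blast
  then have "{l. l < n \<and> v \<notin> ball u l} \<subseteq> {..<l}" by auto
  then have "gdist u v \<le> card {..<l}" unfolding gdist_def by (intro card_mono) auto
  then show "gdist u v \<le> l" by simp
next
  assume *: "gdist u v \<le> l"
  show "v \<in> ball u l"
  proof (rule ccontr)
    assume "v \<notin> ball u l"
    then have "v \<notin> ball u l'" if "l' \<le> l" for l' using ball_mono[OF assms(1)] that by blast
    then have "{..l} \<subseteq> {l. l < n \<and> v \<notin> ball u l}" using assms(2) by auto
    then have "card {..l} \<le> gdist u v" unfolding gdist_def by (intro card_mono) auto
    then show False using * by simp
  qed
qed

lemma gdist_le_ball: "u < n \<Longrightarrow> v \<in> ball u l \<Longrightarrow> gdist u v \<le> l"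
proof (cases "l < n")
  case False
  have "gdist u v \<le> card {..<n}" unfolding gdist_def by (intro card_mono) auto
  then show ?thesis using False by simp
qed (simp add: gdist_le_iff)

lemma gdist_self: "u < n \<Longrightarrow> gdist u u = 0"
  using gdist_le_ball[of u u 0] by simp

lemma gdist_adj: "{u, v} \<in> E \<Longrightarrow> gdist u v \<le> 1"
  using gdist_le_ball[of u v 1] edge_in[of u v] by auto

lemma ball_gdist: "u < n \<Longrightarrow> gdist u v < n \<Longrightarrow> v \<in> ball u (gdist u v)"
  using gdist_le_iff[of u "gdist u v" v] by simp

lemma graph_path_ball:
  assumes "graph_path {..<n} E p" "i \<le> j" "j < length p"
  shows "p ! j \<in> ball (p ! i) (j - i)"
  using assms(2,3)
proof (induction j rule: dec_induct)
  case (step j)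
  have "p ! i < n" using assms(1) step unfolding graph_path_def by (auto simp: subset_iff)
  moreover have "{p ! j, p ! Suc j} \<in> E" using assms(1) step unfolding graph_path_def by auto
  ultimately show ?case using step ball_step[of "p ! i" "p ! j" "j - i" "p ! Suc j"]
    by (simp add: Suc_diff_le del: ball.simps)
qed simp

lemma path_between_ball: "path_between {..<n} E u v p \<Longrightarrow> v \<in> ball u (length p - 1)"
  using graph_path_ball[of p 0 "length p - 1"] unfolding path_between_def graph_path_def
  by (auto simp: hd_conv_nth last_conv_nth)

lemma path_snoc:
  assumes "path_between {..<n} E u w p" "{w, v} \<in> E" "v \<notin> set p"
  shows "path_between {..<n} E u v (p @ [v])"
proof -
  have "{(p @ [v]) ! i, (p @ [v]) ! Suc i} \<in> E" if "i < length p" for i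
  proof (cases "Suc i < length p")
    case True
    then show ?thesis using assms(1) unfolding path_between_def graph_path_def
      by (auto simp: nth_append)
  next
    case False
    then have "i = length p - 1" "p \<noteq> []" using that by auto
    then show ?thesis using assms(1,2) unfolding path_between_def
      by (auto simp: nth_append last_conv_nth)
  qed
  then show ?thesis using assms edge_in[of w v] unfolding path_between_def graph_path_def by auto
qed

lemma path_Cons:
  assumes "path_between {..<n} E u v p" "{w, u} \<in> E" "w \<notin> set p"
  shows "path_between {..<n} E w v (w # p)"
  using assms edge_in[of w u] unfolding path_between_def graph_path_def
  by (auto simp: nth_Cons hd_conv_nth split: nat.splits)

lemma path_start: "path_between {..<n} E u v p \<Longrightarrow> u < n \<and> p \<noteq> []"
  unfolding path_between_def graph_path_def using hd_in_set by blast

lemma path_take: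
  assumes "path_between {..<n} E u w p" "i < length p"
  shows "path_between {..<n} E u (p ! i) (take (Suc i) p)"
proof -
  have "last (take (Suc i) p) = p ! i" using assms(2) by (simp add: take_Suc_conv_app_nth)
  moreover have "{take (Suc i) p ! j, take (Suc i) p ! Suc j} \<in> E"
    if "Suc j < length (take (Suc i) p)" for j
    using assms that unfolding path_between_def graph_path_def by simp
  ultimately show ?thesis using assms path_start[OF assms(1)] set_take_subset[of "Suc i" p]
    unfolding path_between_def graph_path_def by auto
qed

text \<open>Balls describe walks, but a path has distinct vertices. If the next vertex already lies
  on the path, the path is cut there and does not get longer.\<close>

lemma ball_path:
  assumes "u < n" "v \<in> ball u l"
  shows "\<exists>p. path_between {..<n} E u v p \<and> length p \<le> Suc l"
  using assms(2)
proof (induction l arbitrary: v)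
  case 0
  have "path_between {..<n} E u u [u]" using assms(1) by (simp add: path_between_def graph_path_def)
  then show ?case using 0 by force
next
  case (Suc l)
  from Suc(2) obtain w where w: "w \<in> ball u l" "w = v \<or> {w, v} \<in> E" by auto
  obtain p where p: "path_between {..<n} E u w p" "length p \<le> Suc l" using Suc(1) w by blast
  consider "w = v" | "{w, v} \<in> E" "v \<notin> set p" | "v \<in> set p" using w by blast
  then show ?case
  proof cases
    case 1 then show ?thesis using p by (meson le_SucI)
  next
    case 2 then show ?thesis using path_snoc[OF p(1) 2] p(2) by force
  next
    case 3
    then obtain i where "i < length p" "p ! i = v" by (auto simp: in_set_conv_nth)
    then show ?thesis using path_take[OF p(1), of i] p(2) by (intro exI[of _ "take (Suc i) p"]) auto
  qed
qed

lemma path_length_le: "graph_path {..<n} E p \<Longrightarrow> length p \<le> n"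
  unfolding graph_path_def by (metis card_lessThan card_mono distinct_card finite_lessThan)

lemma gdist_less_path:
  assumes "path_between {..<n} E u v p"
  shows "gdist u v < n" "gdist u v < length p"
proof -
  have p: "p \<noteq> []" "u < n" "length p \<le> n"
    using path_start[OF assms] assms path_length_le[of p] unfolding path_between_def by auto
  have "gdist u v \<le> length p - 1" using gdist_le_ball path_between_ball assms p by blast
  then show "gdist u v < length p" using p by (cases p) auto
  then show "gdist u v < n" using p by simp
qed

lemma gdist_less_iff: "u < n \<Longrightarrow> gdist u v < n \<longleftrightarrow> (\<exists>l. v \<in> ball u l)"
  using ball_gdist ball_path gdist_less_path(1) by blast

lemma gdist_path:
  assumes "u < n" "gdist u v < n"
  obtains p where "path_between {..<n} E u v p" "length p = Suc (gdist u v)"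
  using ball_path[OF assms(1) ball_gdist[OF assms]] gdist_less_path(2) by (metis Suc_leI le_antisym)

lemma shortest_path_iff:
  "shortest_path {..<n} E u v p \<longleftrightarrow> path_between {..<n} E u v p \<and> length p = Suc (gdist u v)"
proof
  assume "shortest_path {..<n} E u v p"
  then have p: "path_between {..<n} E u v p" "\<And>q. path_between {..<n} E u v q \<Longrightarrow> length p \<le> length q"
    unfolding shortest_path_def by auto
  have "u < n" using path_start[OF p(1)] by simp
  then show "path_between {..<n} E u v p \<and> length p = Suc (gdist u v)"
    using gdist_path gdist_less_path[OF p(1)] p by (metis Suc_leI le_antisym)
next
  assume "path_between {..<n} E u v p \<and> length p = Suc (gdist u v)"
  then show "shortest_path {..<n} E u v p"
    unfolding shortest_path_def using gdist_less_path(2) by (metis Suc_leI)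
qed

lemma connected_sym: "u < n \<Longrightarrow> gdist u v < n \<Longrightarrow> gdist v u < n"
  by (meson ball_less ball_sym gdist_less_iff)

lemma connected_trans: "u < n \<Longrightarrow> gdist u v < n \<Longrightarrow> gdist v w < n \<Longrightarrow> gdist u w < n"
  by (meson ball_less ball_trans gdist_less_iff)

lemma connected_adj: "{u, v} \<in> E \<Longrightarrow> gdist u v < n"
  using ball_step[of u u 0 v] edge_in[of u v] gdist_less_iff[of u v] by (simp del: ball.simps(2)) blast

section \<open>Conflicting edges and proper colourings\<close>

definition proper :: "(nat set \<Rightarrow> nat) \<Rightarrow> bool" where
  "proper c \<longleftrightarrow> (\<forall>a b a' b'. {a, b} \<in> E \<longrightarrow> {a', b'} \<in> E \<longrightarrow> gdist a b' < n \<longrightarrow>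
     gdist a b' = gdist b a' + 2 \<longrightarrow> c {a, b} \<noteq> c {a', b'})"

text \<open>A shorter connection between two vertices of a shortest path would, by the triangle
  inequality, bring the ends of the whole path closer together.\<close>

lemma gdist_shortest_path:
  assumes "shortest_path {..<n} E u v p" "i \<le> j" "j < length p"
  shows "gdist (p ! i) (p ! j) = j - i"
proof -
  have p: "path_between {..<n} E u v p" "length p = Suc (gdist u v)" "p \<noteq> []"
    using assms(1,3) by (auto simp: shortest_path_iff)
  then have gp: "graph_path {..<n} E p" "hd p = u" "last p = v" by (auto simp: path_between_def)
  have lt: "p ! l < n" if "l < length p" for l
    using gp(1) that unfolding graph_path_def by (auto simp: subset_iff)
  have le: "gdist (p ! i) (p ! j) \<le> j - i"
    by (intro gdist_le_ball lt graph_path_ball gp) (use assms in auto)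
  have un: "u < n" using lt[of 0] gp p(3) by (simp add: hd_conv_nth)
  have "p ! i \<in> ball u i" using graph_path_ball[OF gp(1), of 0 i] assms gp(2) p(3)
    by (simp add: hd_conv_nth)
  moreover have "gdist (p ! i) (p ! j) < n"
    using le path_length_le[OF gp(1)] assms(3) by linarith
  then have "p ! j \<in> ball (p ! i) (gdist (p ! i) (p ! j))" using assms by (intro ball_gdist lt) auto
  ultimately have "p ! j \<in> ball u (i + gdist (p ! i) (p ! j))" using ball_trans un by blast
  moreover have "v \<in> ball (p ! j) (length p - 1 - j)"
    using graph_path_ball[OF gp(1), of j "length p - 1"] assms(3) gp(3) p(3)
    by (auto simp: last_conv_nth)
  ultimately have "v \<in> ball u (i + gdist (p ! i) (p ! j) + (length p - 1 - j))"
    using ball_trans un by blast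
  then have "gdist u v \<le> i + gdist (p ! i) (p ! j) + (length p - 1 - j)"
    using gdist_le_ball un by blast
  then show ?thesis using le p(2) assms(2,3) by linarith
qed

text \<open>For two edges of a shortest path the outer ends are farther apart than the inner ends by
  exactly 2. Conversely, a shortest path between the inner ends, extended by both edges, has the
  length of the outer distance and is therefore shortest.\<close>

lemma very_strong_rainbow_coloring_iff_proper:
  "very_strong_rainbow_coloring {..<n} E c \<longleftrightarrow> proper c"
proof
  assume vs: "very_strong_rainbow_coloring {..<n} E c"
  show "proper c" unfolding proper_def
  proof (intro allI impI)
    fix a b a' b' assume e: "{a, b} \<in> E" "{a', b'} \<in> E" and d: "gdist a b' < n" "gdist a b' = gdist b a' + 2"
    have lt: "a < n" "b < n" "a' < n" "b' < n" using e edge_in by auto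
    obtain q where q: "path_between {..<n} E b a' q" "length q = Suc (gdist b a')"
      using gdist_path[of b a'] lt d by auto
    have qn: "q \<noteq> []" "graph_path {..<n} E q" "hd q = b" "last q = a'"
      using q(1) by (auto simp: path_between_def graph_path_def)
    \<comment> \<open>If \<open>q\<close> visited \<open>a\<close>, then \<open>b'\<close> could be
      reached from \<open>a\<close> by at most \<open>length q\<close> edges, one less than
      \<open>gdist a b'\<close>.\<close>
    have "a \<notin> set q"
    proof
      assume "a \<in> set q"
      then obtain i where i: "i < length q" "q ! i = a" by (auto simp: in_set_conv_nth)
      have "a' \<in> ball a (length q - 1 - i)"
        using graph_path_ball[OF qn(2), of i "length q - 1"] i qn by (auto simp: last_conv_nth)
      then have "b' \<in> ball a (Suc (length q - 1 - i))" using ball_step lt e by blast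
      then have "gdist a b' \<le> Suc (length q - 1 - i)" using gdist_le_ball lt by blast
      then show False using d q by simp
    qed
    then have p1: "path_between {..<n} E a a' (a # q)" using path_Cons q e by blast
    have "b' \<notin> set (a # q)"
    proof
      assume "b' \<in> set (a # q)"
      then obtain i where i: "i < length (a # q)" "(a # q) ! i = b'" unfolding in_set_conv_nth by blast
      have "b' \<in> ball a i" using graph_path_ball[of "a # q" 0 i] p1 i
        by (simp add: path_between_def)
      then have "gdist a b' \<le> i" using gdist_le_ball lt by blast
      then show False using d q i by simp
    qed
    then have p2: "path_between {..<n} E a b' ((a # q) @ [b'])" using path_snoc p1 e by blast
    have "shortest_path {..<n} E a b' ((a # q) @ [b'])" using p2 d q by (simp add: shortest_path_iff)
    then have dis: "distinct (map c (path_edges ((a # q) @ [b'])))" (is "distinct ?L")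
      using vs lt unfolding very_strong_rainbow_coloring_def by blast
    have len: "length ?L = Suc (length q)" by (simp add: path_edges_def)
    have "?L ! 0 = c {a, b}" using qn by (simp add: path_edges_def nth_append hd_conv_nth del: upt_Suc)
    moreover have "?L ! length q = c {a', b'}"
      using qn by (simp add: path_edges_def nth_append last_conv_nth nth_Cons' del: upt_Suc)
    moreover have "?L ! 0 \<noteq> ?L ! length q" using dis len qn(1) nth_eq_iff_index_eq[OF dis, of 0 "length q"]
      by simp
    ultimately show "c {a, b} \<noteq> c {a', b'}" by simp
  qed
next
  assume pr: "proper c"
  show "very_strong_rainbow_coloring {..<n} E c" unfolding very_strong_rainbow_coloring_def
  proof (intro ballI allI impI)
    fix u v p assume sp: "shortest_path {..<n} E u v p"
    then have gp: "graph_path {..<n} E p" unfolding shortest_path_def path_between_def by auto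
    have ne: "c {p ! i, p ! Suc i} \<noteq> c {p ! j, p ! Suc j}" if ij: "i < j" "Suc j < length p" for i j
    proof -
      have "{p ! i, p ! Suc i} \<in> E" "{p ! j, p ! Suc j} \<in> E"
        using gp ij unfolding graph_path_def by auto
      moreover have "gdist (p ! i) (p ! Suc j) = gdist (p ! Suc i) (p ! j) + 2"
        using gdist_shortest_path[OF sp] ij by simp
      moreover have "gdist (p ! i) (p ! Suc j) < n"
        using gdist_shortest_path[OF sp, of i "Suc j"] ij path_length_le[OF gp] by simp
      ultimately show ?thesis using pr unfolding proper_def by blast
    qed
    show "distinct (map c (path_edges p))" unfolding distinct_conv_nth
    proof (intro allI impI)
      fix i j assume ij: "i < length (map c (path_edges p))" "j < length (map c (path_edges p))" "i \<noteq> j"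
      then have lt: "Suc i < length p" "Suc j < length p" by (auto simp: path_edges_def)
      from ij(3) consider "i < j" | "j < i" by linarith
      then show "map c (path_edges p) ! i \<noteq> map c (path_edges p) ! j"
      proof cases
        case 1 then show ?thesis using ne[of i j] lt by (auto simp: path_edges_def)
      next
        case 2 then show ?thesis using ne[of j i] lt by (auto simp: path_edges_def)
      qed
    qed
  qed
qed

text \<open>\<open>vsrc\<close> counts the colours used, whatever numbers they are; a bijection
  renames them to numbers below \<open>k\<close>.\<close>

lemma vsrc_le_iff: "vsrc {..<n} E \<le> k \<longleftrightarrow> (\<exists>c. proper c \<and> (\<forall>e\<in>E. c e < k))"
proof
  assume le: "vsrc {..<n} E \<le> k"
  obtain f :: "nat set \<Rightarrow> nat" where f: "inj_on f E"
    using finite_imp_inj_to_nat_seg[OF finite_edges] by blast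
  \<comment> \<open>The \<open>LEAST\<close> is attained because giving every edge its own colour is
    proper: no edge conflicts with itself.\<close>
  have "proper f" unfolding proper_def
  proof (intro allI impI notI)
    fix a b a' b' assume e: "{a, b} \<in> E" "{a', b'} \<in> E" "gdist a b' = gdist b a' + 2" "f {a, b} = f {a', b'}"
    then have "{a, b} = {a', b'}" using f by (simp add: inj_on_def)
    then have "b' = a \<or> b' = b" by blast
    then show False using e gdist_self[of a] edge_in[OF e(1)] gdist_adj[OF e(1)] by auto
  qed
  then have "\<exists>m c. very_strong_rainbow_coloring {..<n} E c \<and> card (c ` E) = m"
    using very_strong_rainbow_coloring_iff_proper by blast
  from LeastI_ex[OF this] obtain c where c: "proper c" "card (c ` E) \<le> k"
    using le unfolding vsrc_def very_strong_rainbow_coloring_iff_proper by auto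
  have "finite (c ` E)" using finite_edges by simp
  then obtain h where h: "bij_betw h (c ` E) {0..<card (c ` E)}" using ex_bij_betw_finite_nat by blast
  have "h (c e) < k" if "e \<in> E" for e using bij_betwE[OF h] that c(2) by force
  moreover have "proper (h \<circ> c)" unfolding proper_def
  proof (intro allI impI)
    fix a b a' b' assume e: "{a, b} \<in> E" "{a', b'} \<in> E" "gdist a b' < n" "gdist a b' = gdist b a' + 2"
    then have "c {a, b} \<noteq> c {a', b'}" using c(1) unfolding proper_def by blast
    then show "(h \<circ> c) {a, b} \<noteq> (h \<circ> c) {a', b'}" using h e unfolding bij_betw_def inj_on_def by auto
  qed
  ultimately show "\<exists>c. proper c \<and> (\<forall>e\<in>E. c e < k)" by (metis comp_apply)
next
  assume "\<exists>c. proper c \<and> (\<forall>e\<in>E. c e < k)"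
  then obtain c where c: "proper c" "\<forall>e\<in>E. c e < k" by blast
  have "vsrc {..<n} E \<le> card (c ` E)" unfolding vsrc_def
    by (rule Least_le) (use c very_strong_rainbow_coloring_iff_proper in auto)
  also have "\<dots> \<le> card {..<k}" by (intro card_mono) (use c in auto)
  finally show "vsrc {..<n} E \<le> k" by simp
qed

definition nbrs :: "nat \<Rightarrow> nat set" where "nbrs v = {u. u < n \<and> {v, u} \<in> E}"

text \<open>Ordered pairs including the diagonal, so that a clique of d neighbours contributes
  exactly d^2.\<close>

definition nbr_pairs :: "nat \<Rightarrow> (nat \<times> nat) set" where
  "nbr_pairs v = {(u, w). u \<in> nbrs v \<and> w \<in> nbrs v \<and> (u = w \<or> {u, w} \<in> E)}"

lemma finite_nbrs: "finite (nbrs v)" and finite_nbr_pairs: "finite (nbr_pairs v)"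
proof -
  show "finite (nbrs v)" by (simp add: nbrs_def)
  then have "finite (nbrs v \<times> nbrs v)" by simp
  then show "finite (nbr_pairs v)" by (rule rev_finite_subset) (auto simp: nbr_pairs_def)
qed

text \<open>Edges at \<open>v\<close> of the same colour lead to pairwise adjacent neighbours, so the neighbourhood
  is covered by \<open>k\<close> cliques and is dense.\<close>

lemma proper_dense:
  assumes c: "proper c" "\<forall>e\<in>E. c e < k"
  shows "(card (nbrs v))\<^sup>2 \<le> k * card (nbr_pairs v)"
proof -
  have "(card (nbrs v))\<^sup>2 \<le> k * card {(u, w). u \<in> nbrs v \<and> w \<in> nbrs v \<and> c {v, u} = c {v, w}}"
    by (rule card_square_le_card_monochromatic) (use c finite_nbrs in \<open>auto simp: nbrs_def\<close>)
  also have "\<dots> \<le> k * card (nbr_pairs v)"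
  proof (intro mult_left_mono card_mono finite_nbr_pairs subsetI)
    fix x assume "x \<in> {(u, w). u \<in> nbrs v \<and> w \<in> nbrs v \<and> c {v, u} = c {v, w}}"
    then obtain u w where x: "x = (u, w)" "u \<in> nbrs v" "w \<in> nbrs v" "c {v, u} = c {v, w}" by blast
    have "u = w \<or> {u, w} \<in> E"
    proof (rule ccontr)
      assume ne: "\<not> (u = w \<or> {u, w} \<in> E)"
      have e: "{u, v} \<in> E" "{v, w} \<in> E" using x by (auto simp: nbrs_def insert_commute)
      have lt: "u < n" "v < n" "w < n" "u \<noteq> v" "v \<noteq> w" using edge_in[OF e(1)] edge_in[OF e(2)] by auto
      have n1: "1 < n" using lt by linarith
      have "w \<notin> ball u 1" using ne by auto
      then have "\<not> gdist u w \<le> 1" using gdist_le_iff[OF lt(1) n1] by simp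
      moreover have "v \<in> ball u 1" using e lt by auto
      then have "w \<in> ball u 2" using ball_step[of u v 1 w] lt e by (simp add: numeral_2_eq_2)
      then have "gdist u w \<le> 2" using gdist_le_ball lt by blast
      \<comment> \<open>The conflict criterion is applied with both inner ends equal to
        \<open>v\<close>.\<close>
      ultimately have "gdist u w = gdist v v + 2" using gdist_self lt by simp
      moreover have "gdist u w < n" using connected_trans connected_adj e lt by blast
      ultimately have "c {u, v} \<noteq> c {v, w}" using c(1) e unfolding proper_def by blast
      then show False using x by (simp add: insert_commute)
    qed
    then show "x \<in> nbr_pairs v" using x by (auto simp: nbr_pairs_def)
  qed simp
  finally show ?thesis .
qed

text \<open>The edges of a shortest path need pairwise different colours, and only \<open>k\<close>
  are available.\<close>

lemma proper_gdist_le: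
  assumes c: "proper c" "\<forall>e\<in>E. c e < k" and "u < n" "gdist u v < n"
  shows "gdist u v \<le> k"
proof -
  obtain p where p: "path_between {..<n} E u v p" "length p = Suc (gdist u v)"
    using gdist_path assms by blast
  have "v < n" using ball_less ball_gdist assms by blast
  then have d: "distinct (map c (path_edges p))"
    using c(1) p assms(3) unfolding very_strong_rainbow_coloring_iff_proper[symmetric]
      very_strong_rainbow_coloring_def by (simp add: shortest_path_iff)
  have "set (map c (path_edges p)) \<subseteq> {..<k}"
    using p(1) c(2) by (auto simp: path_edges_def path_between_def graph_path_def)
  then have "card (set (map c (path_edges p))) \<le> k" by (metis card_lessThan card_mono finite_lessThan)
  then show ?thesis using distinct_card[OF d] p by (simp add: path_edges_def)
qed

section \<open>Splitting the problem along components\<close>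

definition comp_vertices :: "nat \<Rightarrow> nat set" where "comp_vertices r = {w. w < n \<and> gdist r w < n}"

text \<open>Each vertex brings itself and at most \<open>D\<close> neighbours into the next
  ball.\<close>

lemma card_ball_le:
  assumes "u < n" "\<And>v. v < n \<Longrightarrow> card (nbrs v) \<le> D"
  shows "finite (ball u l) \<and> card (ball u l) \<le> (D + 1) ^ l"
proof (induction l)
  case (Suc l)
  have sub: "ball u (Suc l) \<subseteq> (\<Union>w\<in>ball u l. insert w (nbrs w))" by (auto simp: nbrs_def)
  have fin: "finite (\<Union>w\<in>ball u l. insert w (nbrs w))" using Suc finite_nbrs by auto
  have "card (\<Union>w\<in>ball u l. insert w (nbrs w)) \<le> (\<Sum>w\<in>ball u l. card (insert w (nbrs w)))"
    using Suc by (intro card_UN_le) auto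
  also have "\<dots> \<le> (\<Sum>w\<in>ball u l. D + 1)"
  proof (rule sum_mono)
    fix w assume "w \<in> ball u l"
    then have "card (nbrs w) \<le> D" using assms ball_less by blast
    then show "card (insert w (nbrs w)) \<le> D + 1" using card_insert_le_m1[of "D + 1" "nbrs w" w] by simp
  qed
  also have "\<dots> \<le> (D + 1) ^ l * (D + 1)" using Suc by (simp del: One_nat_def)
  finally have "card (ball u (Suc l)) \<le> (D + 1) ^ Suc l" using card_mono[OF fin sub]
    by (simp only: power_Suc2 le_trans)
  then show ?case using finite_subset[OF sub fin] by blast
qed simp

lemma card_comp_vertices_le:
  assumes "r < n" "\<And>v. v < n \<Longrightarrow> card (nbrs v) \<le> D" "\<And>v. gdist r v < n \<Longrightarrow> gdist r v \<le> k"
  shows "card (comp_vertices r) \<le> (D + 1) ^ k"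
proof -
  have "comp_vertices r \<subseteq> ball r k"
    using assms(1,3) ball_gdist ball_mono unfolding comp_vertices_def by blast
  then show ?thesis using card_ball_le[OF assms(1,2)] card_mono le_trans by meson
qed

text \<open>Only \<open>a\<close> is tied to the component of \<open>r\<close>; the second edge
  falls into it through \<open>gdist a b' < n\<close>.\<close>

definition comp_proper :: "nat \<Rightarrow> nat \<Rightarrow> (nat set \<Rightarrow> nat) \<Rightarrow> bool" where
  "comp_proper k r c \<longleftrightarrow> (\<forall>a b. gdist r a < n \<longrightarrow> {a, b} \<in> E \<longrightarrow> c {a, b} < k \<and>
     (\<forall>a' b'. {a', b'} \<in> E \<longrightarrow> gdist a b' < n \<longrightarrow>
       gdist a b' = gdist b a' + 2 \<longrightarrow> c {a, b} \<noteq> c {a', b'}))"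

lemma proper_iff_comp_proper:
  "(\<exists>c. proper c \<and> (\<forall>e\<in>E. c e < k)) \<longleftrightarrow> (\<forall>r<n. \<exists>c. comp_proper k r c)"
proof
  assume "\<exists>c. proper c \<and> (\<forall>e\<in>E. c e < k)"
  then show "\<forall>r<n. \<exists>c. comp_proper k r c" unfolding proper_def comp_proper_def by blast
next
  assume "\<forall>r<n. \<exists>c. comp_proper k r c"
  then obtain cc where cc: "\<And>r. r < n \<Longrightarrow> comp_proper k r (cc r)" by metis
  \<comment> \<open>The colourings \<open>cc r\<close> for different \<open>r\<close> in one
    component may disagree, so each component uses that of its least vertex.\<close>
  define rep where "rep u = (LEAST r. r < n \<and> gdist r u < n)" for u
  have rep: "rep u < n \<and> gdist (rep u) u < n" if "u < n" for u
    unfolding rep_def by (rule LeastI[of _ u]) (use that gdist_self in auto)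
  have rep_eq: "rep u = rep v" if "u < n" "gdist u v < n" for u v
  proof -
    have v: "v < n" using that ball_less ball_gdist by blast
    have "(r < n \<and> gdist r u < n) \<longleftrightarrow> (r < n \<and> gdist r v < n)" for r
      using connected_trans connected_sym that v by meson
    then show ?thesis unfolding rep_def by simp
  qed
  \<comment> \<open>\<open>Min e\<close> merely picks an endpoint; both ends of an edge have the
    same representative.\<close>
  define c where "c e = cc (rep (Min e)) e" for e
  have c: "c {a, b} = cc (rep a) {a, b}" if "{a, b} \<in> E" for a b
  proof -
    have "Min {a, b} = a \<or> Min {a, b} = b" by (simp add: min_def)
    then show ?thesis using rep_eq[of a b] connected_adj that edge_in[OF that] unfolding c_def by auto
  qed
  have "proper c" unfolding proper_def
  proof (intro allI impI)
    fix a b a' b' assume e: "{a, b} \<in> E" "{a', b'} \<in> E" "gdist a b' < n" "gdist a b' = gdist b a' + 2"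
    have lt: "a < n" "b < n" "a' < n" "b' < n" using e edge_in by auto
    have "rep a = rep b'" using rep_eq e lt by blast
    then have "rep a' = rep a" using rep_eq[of a' b'] connected_adj e lt by simp
    then have "c {a, b} = cc (rep a) {a, b}" "c {a', b'} = cc (rep a) {a', b'}" using c e by auto
    then show "c {a, b} \<noteq> c {a', b'}" using cc[of "rep a"] rep[OF lt(1)] e
      unfolding comp_proper_def by metis
  qed
  moreover have "c e < k" if e: "e \<in> E" for e
  proof -
    obtain a b where ab: "e = {a, b}" "a < b" "b < n" using edgeE[OF e] .
    then have "c e = cc (rep a) e" using c e by auto
    then show ?thesis using cc[of "rep a"] rep[of a] e ab unfolding comp_proper_def by auto
  qed
  ultimately show "\<exists>c. proper c \<and> (\<forall>e\<in>E. c e < k)" by blast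
qed

end


section \<open>Sparsity of graphs of bounded treewidth\<close>

lemma graph_path_dist_relpow:
  assumes "graph_path I F p"
  shows "(hd p, last p) \<in> {(a, b). {a, b} \<in> F} ^^ (length p - 1)"
proof -
  define R where "R = {(a, b). {a, b} \<in> F}"
  have "(p ! 0, p ! j) \<in> R ^^ j" if "j < length p" for j
    using that
  proof (induction j)
    case (Suc j)
    then have "(p ! j, p ! Suc j) \<in> R" using assms by (auto simp: R_def graph_path_def)
    then show ?case using Suc by (auto intro: relcompI)
  qed simp
  then show ?thesis using assms unfolding R_def[symmetric]
    by (auto simp: graph_path_def hd_conv_nth last_conv_nth)
qed

section \<open>Rooted trees and connected sets of nodes\<close>

locale rooted_tree =
  fixes I :: "nat set" and F :: "nat set set" and root :: nat
  assumes tree: "tree_graph I F" and root: "root \<in> I"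
begin

definition rel :: "(nat \<times> nat) set" where "rel = {(a, b). {a, b} \<in> F}"

text \<open>Relation powers describe walks, so dropping the last step yields a neighbour one level
  up without any care for distinctness.\<close>

definition depth :: "nat \<Rightarrow> nat" where "depth i = (LEAST l. (root, i) \<in> rel ^^ l)"

lemma edge_in: "{a, b} \<in> F \<Longrightarrow> a \<in> I \<and> b \<in> I \<and> a \<noteq> b"
proof -
  assume "{a, b} \<in> F"
  then have "{a, b} \<subseteq> I" "card {a, b} = 2" using tree unfolding tree_graph_def simple_graph_def by auto
  then show ?thesis by (cases "a = b") auto
qed

lemma depth_relpow: "i \<in> I \<Longrightarrow> (root, i) \<in> rel ^^ depth i"
proof -
  assume "i \<in> I"
  then obtain p where "path_between I F root i p"
    using tree root unfolding tree_graph_def connected_graph_def by blast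
  then have "(root, i) \<in> rel ^^ (length p - 1)"
    using graph_path_dist_relpow[of I F p] unfolding path_between_def rel_def by auto
  then show ?thesis unfolding depth_def by (rule LeastI)
qed

definition par :: "nat \<Rightarrow> nat" where "par i = (SOME j. {i, j} \<in> F \<and> depth i = Suc (depth j))"

lemma par: assumes "i \<in> I" "depth i > 0" shows "{i, par i} \<in> F \<and> depth i = Suc (depth (par i))"
proof -
  obtain l where l: "depth i = Suc l" using assms(2) gr0_implies_Suc by blast
  then obtain j where j: "(root, j) \<in> rel ^^ l" "(j, i) \<in> rel" using depth_relpow[OF assms(1)] by auto
  have "depth j \<le> l" unfolding depth_def by (rule Least_le) (rule j)
  have "j \<in> I" using j(2) edge_in[of j i] by (auto simp: rel_def)
  then have "(root, i) \<in> rel ^^ Suc (depth j)" using depth_relpow j(2) by auto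
  then have "depth i \<le> Suc (depth j)" unfolding depth_def[of i] by (rule Least_le)
  then have "{i, j} \<in> F \<and> depth i = Suc (depth j)"
    using l \<open>depth j \<le> l\<close> j(2) by (auto simp: rel_def insert_commute)
  then show ?thesis unfolding par_def by (rule someI)
qed

lemma depth_0: "i \<in> I \<Longrightarrow> depth i = 0 \<Longrightarrow> i = root"
  using depth_relpow[of i] by simp

lemma par_chain: "i \<in> I \<Longrightarrow> a \<le> depth i \<Longrightarrow> (par ^^ a) i \<in> I \<and> depth ((par ^^ a) i) = depth i - a"
proof (induction a)
  case (Suc a)
  then have "(par ^^ a) i \<in> I" "depth ((par ^^ a) i) = depth i - a" by auto
  then show ?case using par[of "(par ^^ a) i"] edge_in Suc(3) by auto
qed simp

lemma par_chain_inj: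
  assumes "i \<in> I" "a \<le> depth i" "b \<le> depth i" "(par ^^ a) i = (par ^^ b) i"
  shows "a = b"
  using par_chain[OF assms(1,2)] par_chain[OF assms(1,3)] assms by simp

text \<open>If neither endpoint of an edge is the parent of the other, the two chains of ancestors up to
  their first common node close up with the edge to a cycle.\<close>

lemma edge_par:
  assumes e: "{i, j} \<in> F"
  shows "depth i = Suc (depth j) \<and> par i = j \<or> depth j = Suc (depth i) \<and> par j = i"
proof (rule ccontr)
  assume no: "\<not> ?thesis"
  have ij: "i \<in> I" "j \<in> I" "i \<noteq> j" using edge_in[OF e] by auto
  define P where "P a \<longleftrightarrow> a \<le> depth i \<and> (\<exists>b\<le>depth j. (par ^^ a) i = (par ^^ b) j)" for a
  have "(par ^^ depth i) i = root" "(par ^^ depth j) j = root"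
    using par_chain[OF ij(1), of "depth i"] par_chain[OF ij(2), of "depth j"] depth_0 by auto
  then have "P (depth i)" unfolding P_def by auto
  \<comment> \<open>Minimality keeps the ancestors of \<open>i\<close> before the meeting point off
    the chain of \<open>j\<close>, so the cycle has no repeated node.\<close>
  define a where "a = (LEAST a. P a)"
  have "P a" unfolding a_def by (rule LeastI) (rule \<open>P (depth i)\<close>)
  have least: "\<not> P a'" if "a' < a" for a' using that not_less_Least unfolding a_def by blast
  obtain b where ab: "a \<le> depth i" "b \<le> depth j" "(par ^^ a) i = (par ^^ b) j"
    using \<open>P a\<close> unfolding P_def by blast
  \<comment> \<open>Up from \<open>i\<close> to the meeting point and down again to
    \<open>j\<close>; \<open>b\<close> is excluded because the meeting point is already
    listed.\<close>
  define p where "p = map (\<lambda>x. (par ^^ x) i) [0..<Suc a] @ rev (map (\<lambda>x. (par ^^ x) j) [0..<b])"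
  have len: "length p = Suc (a + b)" by (simp add: p_def)
  have dist: "distinct p"
  proof -
    have "distinct (map (\<lambda>x. (par ^^ x) i) [0..<Suc a])"
      unfolding distinct_map using par_chain_inj[OF ij(1)] ab by (auto simp: inj_on_def simp del: upt_Suc)
    moreover have "distinct (map (\<lambda>x. (par ^^ x) j) [0..<b])"
      unfolding distinct_map using par_chain_inj[OF ij(2)] ab by (auto simp: inj_on_def)
    moreover have "(par ^^ x) i \<noteq> (par ^^ y) j" if "x \<le> a" "y < b" for x y
    proof (cases "x = a")
      case True
      then show ?thesis using par_chain_inj[OF ij(2), of b y] ab that by auto
    next
      case False
      then have "\<not> P x" using least that by simp
      then show ?thesis using that ab unfolding P_def by (meson le_trans less_imp_le)
    qed
    ultimately show ?thesis unfolding p_def by (auto simp del: upt_Suc)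
  qed
  have step: "{(par ^^ x) u, (par ^^ Suc x) u} \<in> F" if "u \<in> I" "x < depth u" for u x
    using par[of "(par ^^ x) u"] par_chain[of u x] that by simp
  have p1: "p ! x = (par ^^ x) i" if "x \<le> a" for x
    using that by (simp add: p_def nth_append del: upt_Suc)
  have p2: "p ! x = (par ^^ (a + b - x)) j" if "a \<le> x" "x \<le> a + b" for x
  proof (cases "x = a")
    case False
    then have "a < x" using that by simp
    then obtain y where "x = Suc a + y" using less_iff_Suc_add[of a x] by auto
    then show ?thesis using that by (simp add: p_def nth_append rev_nth del: upt_Suc)
  qed (use p1 ab in simp)
  have edges: "{p ! x, p ! Suc x} \<in> F" if "x < a + b" for x
  proof (cases "x < a")
    case True
    then show ?thesis using p1[of x] p1[of "Suc x"] step[OF ij(1), of x] ab by simp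
  next
    case False
    then have "p ! x = (par ^^ Suc (a + b - Suc x)) j" "p ! Suc x = (par ^^ (a + b - Suc x)) j"
      using p2[of x] p2[of "Suc x"] that by (simp_all add: Suc_diff_Suc del: funpow.simps)
    then show ?thesis using step[OF ij(2), of "a + b - Suc x"] ab that False
      by (simp add: insert_commute del: funpow.simps)
  qed
  have "p \<noteq> []" using len by auto
  have hl: "hd p = i" "last p = j" using p1[of 0] p2[of "a + b"] len \<open>p \<noteq> []\<close>
    by (auto simp: hd_conv_nth last_conv_nth)
  have "p ! x \<in> I" if "x < length p" for x
    using p1[of x] p2[of x] par_chain[OF ij(1), of x] par_chain[OF ij(2), of "a + b - x"] ab that len
    by (cases "x \<le> a") auto
  then have "set p \<subseteq> I" by (auto simp: in_set_conv_nth)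
  then have gp: "graph_path I F p" using \<open>p \<noteq> []\<close> dist edges len unfolding graph_path_def by auto
  \<comment> \<open>A cycle needs three nodes. The smaller cases are \<open>i = j\<close> and the
    two parent relations excluded by \<open>no\<close>.\<close>
  have "a + b \<ge> 2"
  proof (rule ccontr)
    assume "\<not> 2 \<le> a + b"
    then consider "a = 0" "b = 0" | "a = 1" "b = 0" | "a = 0" "b = 1" by linarith
    then show False
    proof cases
      case 1 then show False using ab ij by simp
    next
      case 2 then show False using ab no par[OF ij(1)] by simp
    next
      case 3 then show False using ab no par[OF ij(2)] by simp
    qed
  qed
  then have "length p \<ge> 3" "{last p, hd p} \<in> F" using len hl e by (auto simp: insert_commute)
  then show False using gp tree unfolding tree_graph_def acyclic_graph_def by blast
qed

text \<open>Along a path inside \<open>T\<close> starting at its topmost node \<open>h\<close>,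
  every edge leads to a child or to the parent. So the ancestor chain up to \<open>h\<close> either
  gains a node of \<open>T\<close> or loses its first one, and never leaves
  \<open>T\<close>.\<close>

lemma connected_top:
  assumes T: "T \<subseteq> I" "connected_graph T {e \<in> F. e \<subseteq> T}"
    and h: "h \<in> T" "\<And>i. i \<in> T \<Longrightarrow> depth h \<le> depth i" and z: "z \<in> T"
  shows "(par ^^ (depth z - depth h)) z = h" "\<And>x. x \<le> depth z - depth h \<Longrightarrow> (par ^^ x) z \<in> T"
proof -
  obtain p where p: "path_between T {e \<in> F. e \<subseteq> T} h z p"
    using T(2) h(1) z unfolding connected_graph_def by blast
  then have gp: "graph_path T {e \<in> F. e \<subseteq> T} p" "hd p = h" "last p = z" "p \<noteq> []"
    by (auto simp: path_between_def graph_path_def)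
  have "(par ^^ (depth (p ! y) - depth h)) (p ! y) = h \<and>
      (\<forall>x \<le> depth (p ! y) - depth h. (par ^^ x) (p ! y) \<in> T)" if "y < length p" for y
    using that
  proof (induction y)
    case 0
    then show ?case using gp h(1) by (simp add: hd_conv_nth)
  next
    case (Suc y)
    let ?u = "p ! y" and ?v = "p ! Suc y"
    have uv: "{?u, ?v} \<in> F" "?u \<in> T" "?v \<in> T" using gp(1) Suc(2) unfolding graph_path_def by auto
    have IH: "(par ^^ (depth ?u - depth h)) ?u = h"
      "\<And>x. x \<le> depth ?u - depth h \<Longrightarrow> (par ^^ x) ?u \<in> T" using Suc by auto
    from edge_par[OF uv(1)] show ?case
    proof
      assume d: "depth ?u = Suc (depth ?v) \<and> par ?u = ?v"
      have s: "depth ?u - depth h = Suc (depth ?v - depth h)" using d h(2)[OF uv(3)] by simp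
      have "(par ^^ x) ?v = (par ^^ Suc x) ?u" for x using d by (simp add: funpow_swap1)
      then show ?thesis using IH s by (metis Suc_le_mono)
    next
      assume d: "depth ?v = Suc (depth ?u) \<and> par ?v = ?u"
      have s: "depth ?v - depth h = Suc (depth ?u - depth h)" using d h(2)[OF uv(2)] by simp
      have *: "(par ^^ Suc x) ?v = (par ^^ x) ?u" for x using d by (simp add: funpow_swap1)
      have "(par ^^ x) ?v \<in> T" if "x \<le> Suc (depth ?u - depth h)" for x
        using that * IH(2) uv(3) by (cases x) (auto simp del: funpow.simps(2))
      then show ?thesis using IH(1) s * by metis
    qed
  qed
  from this[of "length p - 1"] have "(par ^^ (depth z - depth h)) z = h \<and>
      (\<forall>x \<le> depth z - depth h. (par ^^ x) z \<in> T)" using gp by (simp add: last_conv_nth)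
  then show "(par ^^ (depth z - depth h)) z = h" "\<And>x. x \<le> depth z - depth h \<Longrightarrow> (par ^^ x) z \<in> T"
    by auto
qed

end

text \<open>A single bag works; this ensures that the \<open>LEAST\<close> in
  \<open>treewidth\<close> is attained.\<close>

lemma tree_decomposition_ex:
  assumes "finite V" "\<forall>e\<in>E. e \<subseteq> V"
  shows "\<exists>I F X. tree_decomposition V E I F X"
proof -
  have "tree_graph {0} {}"
    unfolding tree_graph_def simple_graph_def connected_graph_def acyclic_graph_def path_between_def
      graph_path_def by (auto intro!: exI[of _ "[0]"])
  moreover have "connected_graph {0} {}"
    unfolding connected_graph_def path_between_def graph_path_def by (auto intro!: exI[of _ "[0]"])
  ultimately have "tree_decomposition V E {0} {} (\<lambda>_. V)"
    using assms unfolding tree_decomposition_def by auto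
  then show ?thesis by blast
qed

text \<open>Orienting each edge towards the endpoint whose subtree reaches closer to the root, all
  out-neighbours of a vertex lie in the topmost bag of that vertex.\<close>

lemma treewidth_sparse:
  assumes V: "simple_graph V E" and S: "S \<subseteq> V"
  shows "card {(u, w). u \<in> S \<and> w \<in> S \<and> (u = w \<or> {u, w} \<in> E)} \<le> 2 * (treewidth V E + 1) * card S"
proof -
  have fin: "finite V" and ev: "\<forall>e\<in>E. e \<subseteq> V" using V unfolding simple_graph_def by auto
  have "\<exists>w I F X. tree_decomposition V E I F X \<and> decomposition_width I X = w"
    using tree_decomposition_ex[OF fin ev] by blast
  from LeastI_ex[OF this] obtain I F X where
    td: "tree_decomposition V E I F X" and w: "decomposition_width I X = treewidth V E"
    unfolding treewidth_def by blast
  have tr: "tree_graph I F" and cov: "(\<Union>i\<in>I. X i) = V" and edg: "\<And>e. e \<in> E \<Longrightarrow> \<exists>i\<in>I. e \<subseteq> X i"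
    and con: "\<And>v. v \<in> V \<Longrightarrow> connected_graph {i\<in>I. v \<in> X i} {e\<in>F. e \<subseteq> {i\<in>I. v \<in> X i}}"
    using td unfolding tree_decomposition_def by auto
  obtain root where "root \<in> I" using tr unfolding tree_graph_def by auto
  then interpret rooted_tree I F root using tr by unfold_locales
  have finI: "finite I" using tr unfolding tree_graph_def simple_graph_def by auto
  have bag: "card (X i) \<le> treewidth V E + 1" if "i \<in> I" for i
  proof -
    have "card (X i) \<le> Max ((\<lambda>i. card (X i)) ` I)" using finI that by (intro Max_ge) auto
    then show ?thesis using w unfolding decomposition_width_def by linarith
  qed
  define T where "T v = {i\<in>I. v \<in> X i}" for v
  define top where "top v = arg_min depth (\<lambda>i. i \<in> T v)" for v
  have Tne: "\<exists>i. i \<in> T v" if "v \<in> V" for v using cov that by (auto simp: T_def)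
  have top: "top v \<in> T v" "\<And>i. i \<in> T v \<Longrightarrow> depth (top v) \<le> depth i" if "v \<in> V" for v
    using Tne[OF that] arg_min_nat_lemma[of "\<lambda>i. i \<in> T v" _ depth] unfolding top_def by auto
  \<comment> \<open>Some bag \<open>z\<close> holds both \<open>u\<close> and \<open>w\<close>. On
    the way up from \<open>z\<close> the top of \<open>u\<close> is met no later than the top of
    \<open>w\<close>, and up to there every bag contains \<open>w\<close>.\<close>
  have key: "w \<in> X (top u)"
    if uw: "u \<in> V" "w \<in> V" "u = w \<or> {u, w} \<in> E" "depth (top w) \<le> depth (top u)" for u w
  proof (cases "u = w")
    case False
    then obtain z where z: "z \<in> T u" "z \<in> T w" using edg uw unfolding T_def by blast
    have "(par ^^ (depth z - depth (top u))) z = top u"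
      by (rule connected_top(1)[where T = "T u"]) (use top uw con z in \<open>auto simp: T_def\<close>)
    moreover have "(par ^^ (depth z - depth (top u))) z \<in> T w"
      by (rule connected_top(2)[where T = "T w" and h = "top w"])
        (use top uw con z in \<open>auto simp: T_def\<close>)
    ultimately show ?thesis by (simp add: T_def)
  qed (use top uw in \<open>auto simp: T_def\<close>)
  have finS: "finite S" using S fin finite_subset by blast
  \<comment> \<open>Each pair or its reversal joins a vertex to a member of its top bag, with at
    most \<open>treewidth V E + 1\<close> choices. The reversal causes the factor 2.\<close>
  define A where "A = Sigma S (\<lambda>u. X (top u))"
  have finX: "finite (X i)" if "i \<in> I" for i using cov that fin by (meson UN_upper finite_subset)
  have topI: "top u \<in> I" if "u \<in> S" for u using top(1)[of u] that S by (auto simp: T_def)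
  have finA: "finite A" unfolding A_def using finS finX topI by blast
  have "card A \<le> (\<Sum>u\<in>S. treewidth V E + 1)"
    unfolding A_def using finS finX topI by (subst card_SigmaI) (auto intro!: sum_mono bag simp del: One_nat_def sum_constant)
  then have cA: "card A \<le> (treewidth V E + 1) * card S" by (simp add: mult.commute)
  have "{(u, w). u \<in> S \<and> w \<in> S \<and> (u = w \<or> {u, w} \<in> E)} \<subseteq> A \<union> prod.swap ` A"
  proof
    fix x assume "x \<in> {(u, w). u \<in> S \<and> w \<in> S \<and> (u = w \<or> {u, w} \<in> E)}"
    then obtain u w where x: "x = (u, w)" "u \<in> S" "w \<in> S" "u = w \<or> {u, w} \<in> E" by blast
    show "x \<in> A \<union> prod.swap ` A"
    proof (cases "depth (top w) \<le> depth (top u)")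
      case True
      then show ?thesis using key[of u w] x S unfolding A_def by auto
    next
      case False
      then have "u \<in> X (top w)" using key[of w u] x S by (auto simp: insert_commute)
      then have "(w, u) \<in> A" using x unfolding A_def by auto
      then show ?thesis using x by (auto intro!: image_eqI[of _ _ "(w, u)"])
    qed
  qed
  then have "card {(u, w). u \<in> S \<and> w \<in> S \<and> (u = w \<or> {u, w} \<in> E)} \<le> card (A \<union> prod.swap ` A)"
    using finA by (intro card_mono) auto
  also have "\<dots> \<le> card A + card A"
    using card_Un_le[of A "prod.swap ` A"] card_image_le[OF finA, of prod.swap] by linarith
  finally show ?thesis using cA by simp
qed


section \<open>The decision procedure\<close>

definition SumE :: "expr \<Rightarrow> expr \<Rightarrow> expr" where
  "SumE a b = Fold a (Num 0) (Plus (Var 1) (Skip b))"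

definition NotE :: "expr \<Rightarrow> expr" where "NotE a = Ite a (Num 0) (Num 1)"

text \<open>Nested conditionals evaluate \<open>b\<close> only if \<open>a\<close> is nonzero;
  \<open>mainE\<close> relies on this to withhold the search when a test fails.\<close>

definition AndE :: "expr \<Rightarrow> expr \<Rightarrow> expr" where "AndE a b = Ite a (Ite b (Num 1) (Num 0)) (Num 0)"

definition OrE :: "expr \<Rightarrow> expr \<Rightarrow> expr" where "OrE a b = Ite a (Num 1) (Ite b (Num 1) (Num 0))"

definition ImpE :: "expr \<Rightarrow> expr \<Rightarrow> expr" where "ImpE a b = Ite a (Ite b (Num 1) (Num 0)) (Num 1)"

definition LtE :: "expr \<Rightarrow> expr \<Rightarrow> expr" where "LtE a b = Ite (Minus b a) (Num 1) (Num 0)"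

definition EqE :: "expr \<Rightarrow> expr \<Rightarrow> expr" where
  "EqE a b = Ite (Plus (Minus a b) (Minus b a)) (Num 0) (Num 1)"

definition ExE :: "expr \<Rightarrow> expr \<Rightarrow> expr" where "ExE a b = Ite (SumE a b) (Num 1) (Num 0)"

definition AllE :: "expr \<Rightarrow> expr \<Rightarrow> expr" where "AllE a b = NotE (SumE a (NotE b))"

text \<open>\<open>fold\<close> makes the last argument the outermost \<open>Push\<close>. It is
  stacked first, so the callee sees the arguments in the given order.\<close>

definition call :: "expr \<Rightarrow> expr list \<Rightarrow> expr" where "call f as = fold Push as (Call f)"

lemma iter_sum: "iter (\<lambda>i x. x + g i) 0 n = (\<Sum>i<n. g i)" for g :: "nat \<Rightarrow> nat"
  by (induction n) auto

lemma ev_SumE [simp]: "ev A (SumE a b) xs ys = (\<Sum>i<ev A a xs []. ev A b (i # xs) [])"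
  by (simp add: SumE_def iter_sum)

lemma loops_SumE [simp]: "loops_le B A (SumE a b) xs ys \<longleftrightarrow>
   loops_le B A a xs [] \<and> ev A a xs [] \<le> B \<and> (\<forall>i<ev A a xs []. loops_le B A b (i # xs) [])"
  by (auto simp: SumE_def)

lemma ev_logic [simp]:
  "ev A (NotE a) xs ys = of_bool (ev A a xs [] = 0)"
  "ev A (AndE a b) xs ys = of_bool (ev A a xs [] \<noteq> 0 \<and> ev A b xs [] \<noteq> 0)"
  "ev A (OrE a b) xs ys = of_bool (ev A a xs [] \<noteq> 0 \<or> ev A b xs [] \<noteq> 0)"
  "ev A (ImpE a b) xs ys = of_bool (ev A a xs [] \<noteq> 0 \<longrightarrow> ev A b xs [] \<noteq> 0)"
  "ev A (LtE a b) xs ys = of_bool (ev A a xs [] < ev A b xs [])"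
  "ev A (EqE a b) xs ys = of_bool (ev A a xs [] = ev A b xs [])"
  "ev A (ExE a b) xs ys = of_bool (\<exists>i<ev A a xs []. ev A b (i # xs) [] \<noteq> 0)"
  "ev A (AllE a b) xs ys = of_bool (\<forall>i<ev A a xs []. ev A b (i # xs) [] \<noteq> 0)"
  by (auto simp: NotE_def AndE_def OrE_def ImpE_def LtE_def EqE_def ExE_def AllE_def)

lemma loops_logic [simp]:
  "loops_le B A (NotE a) xs ys \<longleftrightarrow> loops_le B A a xs []"
  "loops_le B A (AndE a b) xs ys \<longleftrightarrow>
     loops_le B A a xs [] \<and> (ev A a xs [] \<noteq> 0 \<longrightarrow> loops_le B A b xs [])"
  "loops_le B A (OrE a b) xs ys \<longleftrightarrow>
     loops_le B A a xs [] \<and> (ev A a xs [] = 0 \<longrightarrow> loops_le B A b xs [])"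
  "loops_le B A (ImpE a b) xs ys \<longleftrightarrow>
     loops_le B A a xs [] \<and> (ev A a xs [] \<noteq> 0 \<longrightarrow> loops_le B A b xs [])"
  "loops_le B A (LtE a b) xs ys \<longleftrightarrow> loops_le B A a xs [] \<and> loops_le B A b xs []"
  "loops_le B A (EqE a b) xs ys \<longleftrightarrow> loops_le B A a xs [] \<and> loops_le B A b xs []"
  "loops_le B A (ExE a b) xs ys \<longleftrightarrow>
   loops_le B A a xs [] \<and> ev A a xs [] \<le> B \<and> (\<forall>i<ev A a xs []. loops_le B A b (i # xs) [])"
  "loops_le B A (AllE a b) xs ys \<longleftrightarrow>
   loops_le B A a xs [] \<and> ev A a xs [] \<le> B \<and> (\<forall>i<ev A a xs []. loops_le B A b (i # xs) [])"
  by (auto simp: NotE_def AndE_def OrE_def ImpE_def LtE_def EqE_def ExE_def AllE_def)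

lemma ev_call [simp]: "ev A (call f as) xs [] = ev A f (map (\<lambda>a. ev A a xs []) as) []"
proof -
  have "ev A (fold Push as e) xs ys = ev A e xs (map (\<lambda>a. ev A a xs []) as @ ys)" for e ys
    by (induction as arbitrary: e ys rule: rev_induct) auto
  then show ?thesis by (simp add: call_def)
qed

lemma loops_call [simp]: "loops_le B A (call f as) xs [] \<longleftrightarrow>
   (\<forall>a\<in>set as. loops_le B A a xs []) \<and> loops_le B A f (map (\<lambda>a. ev A a xs []) as) []"
proof -
  have "loops_le B A (fold Push as e) xs ys \<longleftrightarrow>
     (\<forall>a\<in>set as. loops_le B A a xs []) \<and> loops_le B A e xs (map (\<lambda>a. ev A a xs []) as @ ys)" for e ys
    by (induction as arbitrary: e ys rule: rev_induct) auto
  then show ?thesis by (simp add: call_def)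
qed

section \<open>Arithmetic and bit extraction\<close>

definition mulE :: expr where "mulE = SumE (Var 0) (Var 2)"

lemma ev_mulE [simp]: "ev A mulE [a, b] [] = a * b"
  by (simp add: mulE_def)

text \<open>The loop runs over the first factor alone, so the second may be huge. For this reason
  \<open>powE\<close> puts the base first.\<close>

lemma loops_mulE [simp]: "loops_le B A mulE [a, b] [] \<longleftrightarrow> a \<le> B"
  by (simp add: mulE_def)

definition powE :: expr where "powE = Fold (Var 1) (Num 1) (call mulE [Var 2, Var 1])"

lemma ev_powE [simp]: "ev A powE [a, b] [] = a ^ b"
proof -
  have "iter (\<lambda>i x. a * x) 1 b = a ^ b" by (induction b) auto
  then show ?thesis by (simp add: powE_def)
qed

lemma loops_powE [simp]: "a \<le> B \<Longrightarrow> b \<le> B \<Longrightarrow> loops_le B A powE [a, b] []"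
  by (simp add: powE_def)

text \<open>Without division, halving by counting would need loops as long as \<open>x\<close>.
  Instead the bits above \<open>j\<close> are removed from the top by conditional subtraction of
  powers of two, starting from the bound \<open>x < 2 ^ N\<close>; bit \<open>j\<close> is set iff
  at least \<open>2 ^ j\<close> remains.\<close>

definition bitE :: expr where
  "bitE = NotE (LtE (Fold (Minus (Minus (Var 1) (Num 1)) (Var 2)) (Var 0)
     (Ite (LtE (Var 1) (call powE [Num 2, Minus (Minus (Var 3) (Num 1)) (Var 0)])) (Var 1)
       (Minus (Var 1) (call powE [Num 2, Minus (Minus (Var 3) (Num 1)) (Var 0)]))))
     (call powE [Num 2, Var 2]))"

lemma mod_power_Suc:
  "x mod 2 ^ e = (if x mod 2 ^ Suc e < 2 ^ e then x mod 2 ^ Suc e else x mod 2 ^ Suc e - 2 ^ e)"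
  for x :: nat
proof -
  have "x mod 2 ^ Suc e = 2 ^ e * (x div 2 ^ e mod 2) + x mod 2 ^ e"
    using mod_mult2_eq[of x "2 ^ e" 2] by (simp add: mult.commute)
  moreover have "x mod 2 ^ e < 2 ^ e" by simp
  ultimately show ?thesis by (cases "x div 2 ^ e mod 2 = 0") (auto simp: mod_2_eq_odd)
qed

lemma odd_div_power_iff: "odd (x div 2 ^ j) \<longleftrightarrow> \<not> x mod 2 ^ Suc j < 2 ^ j" for x :: nat
proof -
  have "x mod 2 ^ Suc j = 2 ^ j * (x div 2 ^ j mod 2) + x mod 2 ^ j"
    using mod_mult2_eq[of x "2 ^ j" 2] by (simp add: mult.commute)
  moreover have "x mod 2 ^ j < 2 ^ j" by simp
  ultimately show ?thesis by (cases "odd (x div 2 ^ j)") (auto simp: mod_2_eq_odd)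
qed

lemma ev_bitE [simp]:
  assumes "x < 2 ^ N" "j < N"
  shows "ev A bitE [x, N, j] [] = of_bool (j \<in> set_decode x)"
proof -
  define g where "g = (\<lambda>i (y::nat). if y < 2 ^ (N - 1 - i) then y else y - 2 ^ (N - 1 - i))"
  \<comment> \<open>Loop invariant: after \<open>i\<close> rounds the top \<open>i\<close> of the
    \<open>N\<close> bits are gone.\<close>
  have "iter g x i = x mod 2 ^ (N - i)" if "i \<le> N" for i
    using that
  proof (induction i)
    case 0
    show ?case using assms(1) by simp
  next
    case (Suc i)
    define e where "e = N - 1 - i"
    have e: "N - i = Suc e" "N - Suc i = e" using Suc(2) by (auto simp: e_def)
    have "iter g x (Suc i) = g i (x mod 2 ^ Suc e)" using Suc e(1) by simp
    also have "\<dots> = x mod 2 ^ e" unfolding g_def e_def[symmetric] by (rule mod_power_Suc[symmetric])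
    finally show ?case unfolding e(2) .
  qed
  moreover have "N - (N - 1 - j) = Suc j" using assms(2) by simp
  ultimately have "iter g x (N - 1 - j) = x mod 2 ^ Suc j" by (metis diff_le_self le_trans)
  moreover have "ev A bitE [x, N, j] [] = of_bool (\<not> iter g x (N - 1 - j) < 2 ^ j)"
    by (simp add: bitE_def g_def cong: if_cong)
  ultimately show ?thesis by (simp add: odd_div_power_iff set_decode_def)
qed

lemma loops_bitE [simp]: "N \<le> B \<Longrightarrow> j \<le> B \<Longrightarrow> 2 \<le> B \<Longrightarrow> loops_le B A bitE [x, N, j] []"
  by (simp add: bitE_def)

lemma set_encode_less: "S \<subseteq> {..<N} \<Longrightarrow> set_encode S < 2 ^ N"
proof -
  assume "S \<subseteq> {..<N}"
  then have "set_encode S \<le> (\<Sum>i<N. 2 ^ i)" unfolding set_encode_def by (intro sum_mono2) auto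
  also have "\<dots> < 2 ^ N" using sum_power2[of N] by (simp add: lessThan_atLeast0)
  finally show ?thesis .
qed

section \<open>Expressions for distances, the two tests and the search\<close>

definition adjE :: expr where "adjE = Input (Plus (call mulE [Var 1, Var 0]) (Var 2))"

text \<open>The accumulator is the bit code of the current ball; summing distinct powers of two
  forms the code of the next one.\<close>

definition ballE :: expr where
  "ballE = Fold (Var 2) (call powE [Num 2, Var 1])
     (SumE (Var 2)
       (Ite
         (ExE (Var 3)
           (AndE (call bitE [Var 3, Var 4, Var 0])
                (OrE (EqE (Var 0) (Var 1)) (call adjE [Var 4, Var 0, Var 1]))))
         (call powE [Num 2, Var 0]) (Num 0)))"

definition distE :: expr where
  "distE = SumE (Var 0)
     (NotE (call bitE [call ballE [Var 1, Var 2, Var 0], Var 1, Var 3]))"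

text \<open>The rank of \<open>w\<close> inside the component of \<open>r\<close>, or the component
  size for \<open>w = n\<close>. Ranks keep the length of colouring codes independent of
  \<open>n\<close>.\<close>

definition idxE :: expr where
  "idxE = SumE (Var 2) (LtE (call distE [Var 1, Var 2, Var 0]) (Var 1))"

definition degE :: expr where
  "degE = SumE (Var 0) (call adjE [Var 1, Var 2, Var 0])"

definition pairsE :: expr where
  "pairsE = SumE (Var 0) (SumE (Var 1)
     (AndE (AndE (call adjE [Var 2, Var 3, Var 1]) (call adjE [Var 2, Var 3, Var 0]))
       (OrE (EqE (Var 1) (Var 0)) (call adjE [Var 2, Var 1, Var 0]))))"

definition denseE :: expr where
  "denseE = AllE (Var 0) (NotE (LtE (call mulE [Var 2, call pairsE [Var 1, Var 0]])
     (call mulE [call degE [Var 1, Var 0], call degE [Var 1, Var 0]])))"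

definition diamE :: expr where
  "diamE = AllE (Var 0) (AllE (Var 1)
     (NotE (AndE (LtE (Var 3) (call distE [Var 2, Var 1, Var 0]))
               (LtE (call distE [Var 2, Var 1, Var 0]) (Var 2)))))"

text \<open>Arguments \<open>n, k, r, m, a, b, q\<close>.\<close>

definition codeE :: expr where
  "codeE = Plus
     (call mulE [Var 1, Plus
       (call mulE [call idxE [Var 0, Var 2, Ite (LtE (Var 4) (Var 5)) (Var 4) (Var 5)], Var 3])
       (call idxE [Var 0, Var 2, Ite (LtE (Var 4) (Var 5)) (Var 5) (Var 4)])])
     (Var 6)"

text \<open>Arguments \<open>n, k, r, m, N, x\<close>; the bound variables are \<open>a, b\<close> and then \<open>a', b'\<close>.\<close>

definition checkE :: expr where
  "checkE = AllE (Var 0) (AllE (Var 1)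
     (ImpE (AndE (LtE (call distE [Var 2, Var 4, Var 1]) (Var 2)) (call adjE [Var 2, Var 1, Var 0]))
       (AndE
         (ExE (Var 3)
           (call bitE [Var 8, Var 7, call codeE [Var 3, Var 4, Var 5, Var 6, Var 2, Var 1, Var 0]]))
         (AllE (Var 2) (AllE (Var 3)
           (ImpE (AndE (call adjE [Var 4, Var 1, Var 0])
                  (AndE (LtE (call distE [Var 4, Var 3, Var 0]) (Var 4))
                    (EqE (call distE [Var 4, Var 3, Var 0])
                        (Plus (call distE [Var 4, Var 2, Var 1]) (Num 2)))))
             (AllE (Var 5)
               (NotE (AndE
                 (call bitE [Var 10, Var 9,
                   call codeE [Var 5, Var 6, Var 7, Var 8, Var 4, Var 3, Var 0]])
                 (call bitE [Var 10, Var 9,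
                   call codeE [Var 5, Var 6, Var 7, Var 8, Var 2, Var 1, Var 0]]))))))))))"

definition searchE :: expr where
  "searchE = ExE (call powE [Num 2, Var 4]) (call checkE [Var 1, Var 2, Var 3, Var 4, Var 5, Var 0])"

text \<open>Calls act as let bindings: the component size and the number of bits are computed once
  per component and handed on.\<close>

definition sizedE :: expr where
  "sizedE = call searchE [Var 0, Var 1, Var 2, Var 3,
     call mulE [Var 3, call mulE [Var 3, Var 1]]]"

definition componentE :: expr where
  "componentE = call sizedE [Var 0, Var 1, Var 2, call idxE [Var 0, Var 2, Var 0]]"

definition mainE :: expr where
  "mainE = AndE (call denseE [Var 0, Var 1]) (AndE (call diamE [Var 0, Var 1])
     (AllE (Var 0) (call componentE [Var 1, Var 2, Var 0])))"

section \<open>Correctness and loop bounds of the graph expressions\<close>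

lemma pair_less: "x < m \<Longrightarrow> q < k \<Longrightarrow> k * x + q < m * (k::nat)"
proof -
  assume "x < m" "q < k"
  then have "k * Suc x \<le> k * m" by (intro mult_left_mono) auto
  then show ?thesis using \<open>q < k\<close> by (simp add: mult.commute)
qed

lemma pair_inj: "k * x + q = k * x' + q' \<Longrightarrow> q < k \<Longrightarrow> q' < k \<Longrightarrow> x = x' \<and> q = (q'::nat)"
proof -
  assume *: "k * x + q = k * x' + q'" "q < k" "q' < k"
  have "(k * x + q) div k = x" if "q < k" for x q using that by simp
  then have "x = x'" using * by metis
  then show ?thesis using *(1) by simp
qed

context ugraph
begin

definition adj :: "nat \<Rightarrow> nat" where
  "adj x = (if x < n * n \<and> {x div n, x mod n} \<in> E then 1 else 0)"

lemma ev_adjE [simp]: "u < n \<Longrightarrow> v < n \<Longrightarrow> ev adj adjE [n, u, v] [] = of_bool ({u, v} \<in> E)"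
proof -
  assume "u < n" "v < n"
  then have "Suc u * n \<le> n * n" by (intro mult_right_mono) auto
  then have "u * n + v < n * n" using \<open>v < n\<close> by simp
  then show ?thesis using \<open>v < n\<close> by (simp add: adjE_def adj_def)
qed

lemma loops_adjE [simp]: "u \<le> B \<Longrightarrow> loops_le B A adjE [m, u, v] []"
  by (simp add: adjE_def)

lemma ball_subset: "u < n \<Longrightarrow> ball u l \<subseteq> {..<n}"
  using ball_less by blast

lemma finite_ball: "u < n \<Longrightarrow> finite (ball u l)"
  using finite_subset[OF ball_subset] by simp

lemma ev_ballE [simp]:
  assumes u: "u < n"
  shows "ev adj ballE [n, u, l] [] = set_encode (ball u l)"
proof -
  define g :: "nat \<Rightarrow> nat" where "g x = (\<Sum>v<n. if \<exists>w<n. ev adj bitE [x, n, w] [] \<noteq> 0 \<and> (w = v \<or> {w, v} \<in> E)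
    then 2 ^ v else 0)" for x
  have "ev adj ballE [n, u, l] [] = iter (\<lambda>_. g) (2 ^ u) l"
    by (simp add: ballE_def g_def[abs_def] cong: if_cong conj_cong)
  also have "\<dots> = set_encode (ball u l)"
  proof (induction l)
    case (Suc l)
    define S where "S = ball u l"
    have S: "set_encode S < 2 ^ n" "finite S"
      using ball_subset[OF u] finite_ball[OF u] unfolding S_def by (auto intro: set_encode_less)
    have "iter (\<lambda>_. g) (2 ^ u) (Suc l) = g (set_encode S)" using Suc by (simp add: S_def)
    also have "\<dots> = (\<Sum>v<n. if \<exists>w<n. w \<in> S \<and> (w = v \<or> {w, v} \<in> E) then 2 ^ v else 0)"
      using S by (simp add: g_def cong: if_cong conj_cong)
    also have "\<dots> = set_encode {v. v < n \<and> (\<exists>w<n. w \<in> S \<and> (w = v \<or> {w, v} \<in> E))}"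
      unfolding set_encode_def by (subst sum.inter_filter[symmetric]) (auto intro!: sum.cong)
    finally show ?case by (simp add: S_def)
  qed (simp add: set_encode_def)
  finally show ?thesis .
qed

lemma loops_ballE [simp]:
  "n \<le> B \<Longrightarrow> 2 \<le> B \<Longrightarrow> u \<le> B \<Longrightarrow> l \<le> B \<Longrightarrow> loops_le B A ballE [n, u, l] []"
  by (simp add: ballE_def)

lemma ev_distE [simp]: "u < n \<Longrightarrow> v < n \<Longrightarrow> ev adj distE [n, u, v] [] = gdist u v"
proof -
  assume uv: "u < n" "v < n"
  have "finite (ball u l)" "set_encode (ball u l) < 2 ^ n" for l
    using ball_subset[OF uv(1)] finite_ball[OF uv(1)] by (auto intro: set_encode_less)
  then have "ev adj distE [n, u, v] [] = (\<Sum>l<n. of_bool (v \<notin> ball u l))"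
    using uv by (simp add: distE_def)
  also have "\<dots> = card ({..<n} \<inter> {l. v \<notin> ball u l})" by (simp add: sum_of_bool_eq)
  also have "{..<n} \<inter> {l. v \<notin> ball u l} = {l. l < n \<and> v \<notin> ball u l}" by auto
  finally show ?thesis by (simp add: gdist_def)
qed

lemma loops_distE [simp]:
  "n \<le> B \<Longrightarrow> 2 \<le> B \<Longrightarrow> u \<le> B \<Longrightarrow> v \<le> B \<Longrightarrow> loops_le B A distE [n, u, v] []"
  by (simp add: distE_def)

definition idx :: "nat \<Rightarrow> nat \<Rightarrow> nat" where "idx r w = card {v. v < w \<and> gdist r v < n}"

lemma ev_idxE [simp]: "r < n \<Longrightarrow> w \<le> n \<Longrightarrow> ev adj idxE [n, r, w] [] = idx r w"
proof -
  assume rw: "r < n" "w \<le> n"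
  then have "ev adj idxE [n, r, w] [] = (\<Sum>v<w. of_bool (gdist r v < n))"
    by (simp add: idxE_def)
  also have "\<dots> = card ({..<w} \<inter> {v. gdist r v < n})" by (simp add: sum_of_bool_eq)
  also have "{..<w} \<inter> {v. gdist r v < n} = {v. v < w \<and> gdist r v < n}" by auto
  finally show ?thesis by (simp add: idx_def)
qed

lemma loops_idxE [simp]:
  "n \<le> B \<Longrightarrow> 2 \<le> B \<Longrightarrow> r \<le> B \<Longrightarrow> w \<le> B \<Longrightarrow> loops_le B A idxE [n, r, w] []"
  by (simp add: idxE_def)

lemma idx_le: "idx r w \<le> w"
proof -
  have "idx r w \<le> card {..<w}" unfolding idx_def by (intro card_mono) auto
  then show ?thesis by simp
qed

lemma idx_less: "v < w \<Longrightarrow> gdist r v < n \<Longrightarrow> idx r v < idx r w"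
  unfolding idx_def by (rule psubset_card_mono) auto

text \<open>The rank is strictly increasing on the component; outside it may repeat values.\<close>

lemma idx_inj: "gdist r v < n \<Longrightarrow> gdist r w < n \<Longrightarrow> idx r v = idx r w \<Longrightarrow> v = w"
  using idx_less[of v w r] idx_less[of w v r] by (cases v w rule: linorder_cases) auto

text \<open>Mixed radix code of the two end ranks and the colour \<open>q\<close>, in bases m, m and
  \<open>k\<close> with m = \<open>idx r n\<close>. It is the position of the bit that allows
  \<open>q\<close> for \<open>e\<close>; \<open>Min\<close> and \<open>Max\<close> make it
  independent of orientation.\<close>

definition code :: "nat \<Rightarrow> nat \<Rightarrow> nat set \<Rightarrow> nat \<Rightarrow> nat" where
  "code k r e q = k * (idx r (Min e) * idx r n + idx r (Max e)) + q"

lemma ev_codeE [simp]: "r < n \<Longrightarrow> a < n \<Longrightarrow> b < n \<Longrightarrow>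
  ev adj codeE [n, k, r, idx r n, a, b, q] [] = code k r {a, b} q"
  by (simp add: codeE_def code_def)

lemma loops_codeE [simp]: "r < n \<Longrightarrow> a < n \<Longrightarrow> b < n \<Longrightarrow> n \<le> B \<Longrightarrow> 2 \<le> B \<Longrightarrow> k \<le> B \<Longrightarrow>
  loops_le B adj codeE [n, k, r, m, a, b, q] []"
  using idx_le[of r a] idx_le[of r b] by (simp add: codeE_def)

lemma adj_connected: "r < n \<Longrightarrow> {a, b} \<in> E \<Longrightarrow> gdist r a < n \<longleftrightarrow> gdist r b < n"
  using connected_trans connected_adj by (metis insert_commute)

lemma Min_Max_connected:
  assumes "r < n" "{a, b} \<in> E" "gdist r a < n"
  shows "gdist r (Min {a, b}) < n \<and> gdist r (Max {a, b}) < n"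
    "Min {a, b} < n \<and> Max {a, b} < n"
  using adj_connected[OF assms(1,2)] assms(3) edge_in[OF assms(2)] by (auto simp: min_def max_def)

lemma code_less:
  assumes "r < n" "{a, b} \<in> E" "gdist r a < n" "q < k"
  shows "code k r {a, b} q < idx r n * (idx r n * k)"
proof -
  note c = Min_Max_connected[OF assms(1-3)]
  have "idx r (Min {a, b}) < idx r n" "idx r (Max {a, b}) < idx r n" using c idx_less by blast+
  then have *: "idx r n * idx r (Min {a, b}) + idx r (Max {a, b}) < idx r n * idx r n"
    using pair_less by blast
  have "code k r {a, b} q = k * (idx r n * idx r (Min {a, b}) + idx r (Max {a, b})) + q"
    by (simp only: code_def mult.commute)
  also have "\<dots> < idx r n * idx r n * k" using pair_less[OF * assms(4)] .
  finally show ?thesis by (simp only: mult.assoc)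
qed

text \<open>Digits determine ranks, but ranks determine vertices only inside the component, so both
  edges have to lie there.\<close>

lemma code_inj:
  assumes r: "r < n" and e: "{a, b} \<in> E" "gdist r a < n" and e': "{a', b'} \<in> E" "gdist r a' < n"
    and q: "q < k" "q' < k" and eq: "code k r {a, b} q = code k r {a', b'} q'"
  shows "{a, b} = {a', b'} \<and> q = q'"
proof -
  note c = Min_Max_connected[OF r e] and c' = Min_Max_connected[OF r e']
  have l: "idx r (Max {a, b}) < idx r n" "idx r (Max {a', b'}) < idx r n"
    using c c' idx_less by blast+
  have "idx r (Min {a, b}) * idx r n + idx r (Max {a, b}) =
     idx r (Min {a', b'}) * idx r n + idx r (Max {a', b'}) \<and> q = q'"
    using pair_inj[OF eq[unfolded code_def] q] .
  then have "idx r (Min {a, b}) = idx r (Min {a', b'})" "idx r (Max {a, b}) = idx r (Max {a', b'})" "q = q'"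
    using pair_inj[OF _ l, of "idx r (Min {a, b})" "idx r (Min {a', b'})"] by (auto simp: mult.commute)
  then have "Min {a, b} = Min {a', b'}" "Max {a, b} = Max {a', b'}" "q = q'"
    using idx_inj c c' by blast+
  then show ?thesis by (auto simp: min_def max_def split: if_splits)
qed

text \<open>The bits form a relation between edges and colours: every edge has some colour, and
  conflicting edges share none. Choosing any related colour for each edge gives a colouring.\<close>

definition valid_code :: "nat \<Rightarrow> nat \<Rightarrow> nat \<Rightarrow> bool" where
  "valid_code k r x \<longleftrightarrow> (\<forall>a<n. \<forall>b<n. gdist r a < n \<and> {a, b} \<in> E \<longrightarrow>
     (\<exists>q<k. code k r {a, b} q \<in> set_decode x) \<and>
     (\<forall>a'<n. \<forall>b'<n. {a', b'} \<in> E \<and> gdist a b' < n \<and> gdist a b' = gdist b a' + 2 \<longrightarrow>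
       (\<forall>q<k. \<not> (code k r {a, b} q \<in> set_decode x \<and> code k r {a', b'} q \<in> set_decode x))))"

lemma ev_checkE [simp]:
  assumes r: "r < n" and x: "x < 2 ^ (idx r n * (idx r n * k))"
  shows "ev adj checkE [n, k, r, idx r n, idx r n * (idx r n * k), x] [] = of_bool (valid_code k r x)"
proof -
  have 1: "ev adj bitE [x, idx r n * (idx r n * k), code k r {a, b} q] [] =
      of_bool (code k r {a, b} q \<in> set_decode x)"
    if "gdist r a < n" "{a, b} \<in> E" "q < k" for a b q
    using code_less[OF r that(2,1,3)] x by simp
  \<comment> \<open>\<open>ev_bitE\<close> requires a position below the bit count, so the second
    edge must be placed in the component too; \<open>gdist a b' < n\<close> carries
    \<open>b'\<close> into it.\<close>
  have 2: "ev adj bitE [x, idx r n * (idx r n * k), code k r {a', b'} q] [] =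
      of_bool (code k r {a', b'} q \<in> set_decode x)"
    if "gdist r a < n" "gdist a b' < n" "{a', b'} \<in> E" "q < k" for a a' b' q
    using 1[of a' b' q] that connected_trans[OF r that(1,2)] adj_connected[OF r that(3)] by blast
  show ?thesis unfolding checkE_def valid_code_def
    using r by (simp add: 1 2 cong: conj_cong imp_cong) (metis (no_types, lifting))
qed

lemma loops_checkE [simp]:
  assumes "r < n" "n \<le> B" "2 \<le> B" "k \<le> B" "idx r n * (idx r n * k) \<le> B"
  shows "loops_le B adj checkE [n, k, r, idx r n, idx r n * (idx r n * k), x] []"
proof -
  have c: "code k r {a, b} q \<le> B" if "gdist r a < n" "{a, b} \<in> E" "q < k" for a b q
    using code_less[OF assms(1) that(2,1,3)] assms by linarith
  have c2: "code k r {a', b'} q \<le> B"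
    if "gdist r a < n" "gdist a b' < n" "{a', b'} \<in> E" "q < k" for a a' b' q
    using c[of a' b' q] that connected_trans[OF assms(1) that(1,2)] adj_connected[OF assms(1) that(3)]
    by blast
  show ?thesis unfolding checkE_def using assms c by simp (blast intro: loops_bitE c2)
qed

lemma ex_valid_code_iff:
  assumes r: "r < n"
  shows "(\<exists>x<2 ^ (idx r n * (idx r n * k)). valid_code k r x) \<longleftrightarrow> (\<exists>c. comp_proper k r c)"
proof
  assume "\<exists>x<2 ^ (idx r n * (idx r n * k)). valid_code k r x"
  then obtain x where x: "valid_code k r x" by blast
  define c where "c e = (SOME q. q < k \<and> code k r e q \<in> set_decode x)" for e
  have c: "c {a, b} < k \<and> code k r {a, b} (c {a, b}) \<in> set_decode x"
    if "gdist r a < n" "{a, b} \<in> E" for a b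
    unfolding c_def by (rule someI_ex) (use x that edge_in[OF that(2)] in \<open>auto simp: valid_code_def\<close>)
  have "comp_proper k r c" unfolding comp_proper_def
  proof (intro allI impI conjI notI)
    fix a b assume ab: "gdist r a < n" "{a, b} \<in> E"
    show "c {a, b} < k" using c ab by blast
    fix a' b' assume e: "{a', b'} \<in> E" "gdist a b' < n" "gdist a b' = gdist b a' + 2" "c {a, b} = c {a', b'}"
    have "gdist r a' < n" using connected_trans[OF r ab(1) e(2)] adj_connected[OF r e(1)] by blast
    then have "code k r {a', b'} (c {a, b}) \<in> set_decode x" using c[of a' b'] e by auto
    then show False using c[OF ab] x ab e edge_in[OF ab(2)] edge_in[OF e(1)]
      unfolding valid_code_def by blast
  qed
  then show "\<exists>c. comp_proper k r c" by blast
next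
  assume "\<exists>c. comp_proper k r c"
  then obtain c where c: "comp_proper k r c" by blast
  \<comment> \<open>The graph of \<open>c\<close> on the component, as a set of bit
    positions.\<close>
  define S where "S = {code k r {a, b} (c {a, b}) | a b. gdist r a < n \<and> {a, b} \<in> E}"
  have ck: "c {a, b} < k" if "gdist r a < n" "{a, b} \<in> E" for a b
    using c that unfolding comp_proper_def by blast
  have S: "S \<subseteq> {..<idx r n * (idx r n * k)}" using code_less[OF r] ck unfolding S_def by auto
  then have "finite S" using finite_subset by blast
  then have dec: "set_decode (set_encode S) = S" by simp
  have mem: "code k r {a, b} q \<in> S \<longleftrightarrow> q = c {a, b}" if "gdist r a < n" "{a, b} \<in> E" "q < k" for a b q
  proof
    assume "code k r {a, b} q \<in> S"
    then obtain a' b' where e': "gdist r a' < n" "{a', b'} \<in> E"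
      "code k r {a, b} q = code k r {a', b'} (c {a', b'})" unfolding S_def by blast
    then have "{a, b} = {a', b'} \<and> q = c {a', b'}" using code_inj[OF r that(2,1)] ck that by blast
    then show "q = c {a, b}" by simp
  qed (use that in \<open>auto simp: S_def\<close>)
  have "valid_code k r (set_encode S)" unfolding valid_code_def dec
  proof (intro allI impI conjI notI)
    fix a b assume ab: "gdist r a < n \<and> {a, b} \<in> E"
    show "\<exists>q<k. code k r {a, b} q \<in> S" using mem ck ab by blast
    fix a' b' q assume e: "{a', b'} \<in> E \<and> gdist a b' < n \<and> gdist a b' = gdist b a' + 2" and
      q: "q < k" "code k r {a, b} q \<in> S \<and> code k r {a', b'} q \<in> S"
    have "gdist r a' < n" using connected_trans[OF r] ab e adj_connected[OF r] by blast
    then have "c {a, b} = c {a', b'}" using mem ab e q by blast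
    then show False using c ab e unfolding comp_proper_def by blast
  qed
  then show "\<exists>x<2 ^ (idx r n * (idx r n * k)). valid_code k r x" using set_encode_less[OF S] by blast
qed

lemma ev_componentE [simp]:
  "r < n \<Longrightarrow> ev adj componentE [n, k, r] [] = of_bool (\<exists>c. comp_proper k r c)"
  by (simp add: componentE_def sizedE_def searchE_def ex_valid_code_iff[symmetric] cong: conj_cong)

lemma loops_componentE [simp]:
  assumes "r < n" "n \<le> B" "2 \<le> B" "k \<le> B" "2 ^ (idx r n * (idx r n * k)) \<le> B"
  shows "loops_le B adj componentE [n, k, r] []"
proof -
  \<comment> \<open>The bound on the search loop thereby also covers the loops over bit
    positions.\<close>
  have "idx r n * (idx r n * k) < 2 ^ (idx r n * (idx r n * k))" by (rule less_exp)
  then have "idx r n * (idx r n * k) \<le> B" using assms(5) by linarith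
  moreover have "idx r n \<le> B" using idx_le[of r n] assms(2) by simp
  ultimately show ?thesis using assms by (simp add: componentE_def sizedE_def searchE_def)
qed

lemma ev_degE [simp]: "v < n \<Longrightarrow> ev adj degE [n, v] [] = card (nbrs v)"
proof -
  assume "v < n"
  then have "ev adj degE [n, v] [] = (\<Sum>u<n. of_bool ({v, u} \<in> E))" by (simp add: degE_def)
  also have "\<dots> = card ({..<n} \<inter> {u. {v, u} \<in> E})" by (simp add: sum_of_bool_eq)
  also have "{..<n} \<inter> {u. {v, u} \<in> E} = nbrs v" by (auto simp: nbrs_def)
  finally show ?thesis .
qed

lemma ev_pairsE [simp]: "v < n \<Longrightarrow> ev adj pairsE [n, v] [] = card (nbr_pairs v)"
proof -
  assume "v < n"
  then have "ev adj pairsE [n, v] [] =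
      (\<Sum>u<n. \<Sum>w<n. of_bool ({v, u} \<in> E \<and> {v, w} \<in> E \<and> (u = w \<or> {u, w} \<in> E)))"
    by (simp add: pairsE_def)
  also have "\<dots> = (\<Sum>(u, w)\<in>{..<n} \<times> {..<n}. of_bool ({v, u} \<in> E \<and> {v, w} \<in> E \<and> (u = w \<or> {u, w} \<in> E)))"
    by (rule sum.cartesian_product)
  also have "\<dots> = (\<Sum>p\<in>{..<n} \<times> {..<n}. of_bool (p \<in> nbr_pairs v))"
    by (rule sum.cong) (auto simp: nbr_pairs_def nbrs_def)
  also have "\<dots> = card (({..<n} \<times> {..<n}) \<inter> {p. p \<in> nbr_pairs v})"
    by (simp add: sum_of_bool_eq)
  also have "({..<n} \<times> {..<n}) \<inter> {p. p \<in> nbr_pairs v} = nbr_pairs v"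
    by (auto simp: nbr_pairs_def nbrs_def)
  finally show ?thesis .
qed

definition dense :: "nat \<Rightarrow> bool" where
  "dense k \<longleftrightarrow> (\<forall>v<n. (card (nbrs v))\<^sup>2 \<le> k * card (nbr_pairs v))"

definition diam_le :: "nat \<Rightarrow> bool" where
  "diam_le k \<longleftrightarrow> (\<forall>u<n. \<forall>v<n. gdist u v < n \<longrightarrow> gdist u v \<le> k)"

lemma ev_denseE [simp]: "ev adj denseE [n, k] [] = of_bool (dense k)"
  by (simp add: denseE_def dense_def power2_eq_square not_less)

lemma card_nbrs_le: "card (nbrs v) \<le> n"
proof -
  have "card (nbrs v) \<le> card {..<n}" by (intro card_mono) (auto simp: nbrs_def)
  then show ?thesis by simp
qed

lemma loops_degE [simp]: "n \<le> B \<Longrightarrow> v < n \<Longrightarrow> loops_le B adj degE [n, v] []"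
  by (simp add: degE_def)

lemma loops_pairsE [simp]: "n \<le> B \<Longrightarrow> v < n \<Longrightarrow> loops_le B adj pairsE [n, v] []"
  by (simp add: pairsE_def)

lemma loops_denseE [simp]: "n \<le> B \<Longrightarrow> k \<le> B \<Longrightarrow> loops_le B adj denseE [n, k] []"
  using le_trans[OF card_nbrs_le] by (simp add: denseE_def)

lemma ev_diamE [simp]: "ev adj diamE [n, k] [] = of_bool (diam_le k)"
  by (simp add: diamE_def diam_le_def) (meson not_less)

lemma loops_diamE [simp]: "n \<le> B \<Longrightarrow> 2 \<le> B \<Longrightarrow> loops_le B adj diamE [n, k] []"
  by (simp add: diamE_def)

text \<open>Colourability of all components implies both tests, so they influence the running time
  but not the answer.\<close>

lemma ev_mainE: "ev adj mainE [n, k] [] = (if vsrc {..<n} E \<le> k then 1 else 0)"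
proof -
  have "ev adj mainE [n, k] [] = of_bool (dense k \<and> diam_le k \<and> (\<forall>r<n. \<exists>c. comp_proper k r c))"
    by (simp add: mainE_def)
  moreover have "dense k \<and> diam_le k" if "\<forall>r<n. \<exists>c. comp_proper k r c"
    using that proper_dense proper_gdist_le unfolding proper_iff_comp_proper[symmetric]
      dense_def diam_le_def by blast
  ultimately show ?thesis unfolding vsrc_le_iff proper_iff_comp_proper by auto
qed

definition size_bound :: "nat \<Rightarrow> nat" where
  "size_bound k = (2 * (k * (treewidth {..<n} E + 1)) + 1) ^ k"

lemma idx_le_size_bound:
  assumes "dense k" "diam_le k" "r < n"
  shows "idx r n \<le> size_bound k"
proof -
  define t where "t = treewidth {..<n} E + 1"
  have "card (nbrs v) \<le> 2 * (k * t)" if "v < n" for v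
  proof (cases "card (nbrs v) = 0")
    case False
    have "card (nbr_pairs v) \<le> 2 * t * card (nbrs v)"
      unfolding nbr_pairs_def t_def using treewidth_sparse[OF simple, of "nbrs v"]
      by (auto simp: nbrs_def)
    then have "k * card (nbr_pairs v) \<le> k * (2 * t * card (nbrs v))" by (rule mult_left_mono) simp
    then have "(card (nbrs v))\<^sup>2 \<le> k * (2 * t * card (nbrs v))"
      using assms(1) that unfolding dense_def by (meson le_trans)
    then have "card (nbrs v) * card (nbrs v) \<le> (2 * (k * t)) * card (nbrs v)"
      by (simp add: power2_eq_square ac_simps)
    then show ?thesis using False by simp
  qed simp
  moreover have "gdist r v \<le> k" if "gdist r v < n" for v
    using assms(2,3) ball_less[OF assms(3) ball_gdist[OF assms(3) that]] that
    unfolding diam_le_def by blast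
  ultimately have "card (comp_vertices r) \<le> (2 * (k * t) + 1) ^ k"
    using card_comp_vertices_le[OF assms(3)] by blast
  then show ?thesis unfolding size_bound_def t_def comp_vertices_def idx_def .
qed

text \<open>The size bound is available only for graphs that pass both tests; the short-circuit
  conjunction supplies these assumptions for the search.\<close>

lemma loops_mainE:
  assumes "n \<le> B" "k \<le> B" "2 \<le> B" "2 ^ (size_bound k * (size_bound k * k)) \<le> B"
  shows "loops_le B adj mainE [n, k] []"
proof -
  have "2 ^ (idx r n * (idx r n * k)) \<le> B" if "dense k" "diam_le k" "r < n" for r
  proof -
    have "idx r n * (idx r n * k) \<le> size_bound k * (size_bound k * k)"
      using idx_le_size_bound[OF that] by (intro mult_mono) auto
    then have "(2::nat) ^ (idx r n * (idx r n * k)) \<le> 2 ^ (size_bound k * (size_bound k * k))"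
      by (rule power_increasing) simp
    then show ?thesis using assms(4) by (rule le_trans)
  qed
  then show ?thesis using assms by (simp add: mainE_def)
qed

end

section \<open>Running time and the parameter function\<close>

lemma compile_run:
  assumes "loops_le B (arr s 0) e [reg s 0, reg s 1] []"
  shows "\<exists>T s'. ram_exec (Seq (compile e 2 [0, 1] []) (move 0 2)) s T s' \<and>
    T \<le> time_bound B e + 2 \<and> reg s' 0 = ev (arr s 0) e [reg s 0, reg s 1] []"
proof -
  have "runs (compile e 2 [0, 1] []) s 2 (ev (arr s 0) e [reg s 0, reg s 1] []) (time_bound B e)"
    using compile_correct[of B s e "[0, 1]" "[]" 2] assms by simp
  then obtain T s' where s': "ram_exec (compile e 2 [0, 1] []) s T s'" "T \<le> time_bound B e"
    "reg s' 2 = ev (arr s 0) e [reg s 0, reg s 1] []" unfolding runs_def by blast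
  have "(0::nat) \<noteq> 2" by simp
  show ?thesis using exec_Seq[OF s'(1) exec_move[OF \<open>(0::nat) \<noteq> 2\<close>] refl] s'(2,3) by fastforce
qed

definition sizeE :: expr where
  "sizeE = call powE [Plus (call mulE [Num 2, call mulE [Var 0, Var 1]]) (Num 1), Var 0]"

text \<open>The parameter function as an expression in \<open>k\<close> and \<open>t\<close>, so
  that compiling it proves computability.\<close>

definition boundE :: "nat \<Rightarrow> nat \<Rightarrow> expr" where
  "boundE K H = call mulE [Num K, call powE [Plus (Plus (Var 0) (Num 3))
     (call powE [Num 2, call mulE [sizeE, call mulE [sizeE, Var 0]]]), Num H]]"

theorem theorem3:
  "\<exists>(P :: ram_prog) (f :: nat \<Rightarrow> nat \<Rightarrow> nat) (q :: nat poly).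
     computable2 f \<and>
     (\<forall>(n :: nat) (E :: nat set set) (k :: nat).
        simple_graph {..<n} E \<longrightarrow>
        (\<exists>T s'. ram_exec P (graph_input n E k) T s' \<and>
                T \<le> f k (treewidth {..<n} E + 1) * poly q n \<and>
                reg s' 0 = (if vsrc {..<n} E \<le> k then 1 else 0)))"
proof -
  obtain K H where KH: "\<And>B. time_bound B mainE \<le> K * (B + 1) ^ H"
    using poly_bounded_time_bound[of mainE] unfolding poly_bounded_def by blast
  \<comment> \<open>\<open>K + 2\<close> absorbs the two extra steps of
    \<open>compile_run\<close>.\<close>
  define f where "f k t = ev (\<lambda>_. 0) (boundE (K + 2) H) [k, t] []" for k t
  define M where "M k t = (2 * (k * t) + 1) ^ k" for k t :: nat
  define G where "G k t = k + 3 + 2 ^ (M k t * (M k t * k))" for k t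
  have f: "f k t = (K + 2) * G k t ^ H" for k t
    by (simp add: f_def boundE_def sizeE_def G_def M_def del: One_nat_def)
  have "computable2 f" unfolding computable2_def
  proof (rule exI, intro allI)
    fix a b
    let ?s = "nat_pair_input a b"
    obtain B where "loops_le B (arr ?s 0) (boundE (K + 2) H) [reg ?s 0, reg ?s 1] []"
      using ex_loops_le by blast
    from compile_run[OF this]
    show "\<exists>T s'. ram_exec (Seq (compile (boundE (K + 2) H) 2 [0, 1] []) (move 0 2)) ?s T s' \<and>
        reg s' 0 = f a b"
      by (auto simp: nat_pair_input_def f_def)
  qed
  moreover have "\<exists>T s'. ram_exec (Seq (compile mainE 2 [0, 1] []) (move 0 2)) (graph_input n E k) T s' \<and>
      T \<le> f k (treewidth {..<n} E + 1) * poly ([:1, 1:] ^ H) n \<and>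
      reg s' 0 = (if vsrc {..<n} E \<le> k then 1 else 0)"
    if "simple_graph {..<n} E" for n E k
  proof -
    interpret ugraph n E using that by (rule ugraph.intro)
    let ?s = "graph_input n E k" and ?t = "treewidth {..<n} E + 1"
    \<comment> \<open>Each summand meets one requirement of \<open>loops_mainE\<close>; the 2 is for
      the loops over the base of powers of two.\<close>
    define B where "B = n + k + 2 + 2 ^ (M k ?t * (M k ?t * k))"
    have s: "arr ?s 0 = adj" "reg ?s 0 = n" "reg ?s 1 = k"
      by (auto simp: graph_input_def adj_def fun_eq_iff)
    have sb: "size_bound k = M k ?t" by (simp add: size_bound_def M_def)
    have "loops_le B adj mainE [n, k] []"
      by (rule loops_mainE) (simp_all add: B_def sb)
    then obtain T s' where T: "ram_exec (Seq (compile mainE 2 [0, 1] []) (move 0 2)) ?s T s'"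
      "T \<le> time_bound B mainE + 2" "reg s' 0 = ev adj mainE [n, k] []"
      using compile_run[of B ?s mainE] s by auto
    define g where "g = G k ?t"
    have "1 \<le> g" by (simp add: g_def G_def)
    then have "n + g \<le> n * g + g" by simp
    moreover have "B + 1 = n + g" by (simp add: B_def g_def G_def)
    ultimately have "B + 1 \<le> (n + 1) * g" by simp
    then have "(B + 1) ^ H \<le> ((n + 1) * g) ^ H" by (rule power_mono) simp
    then have "K * (B + 1) ^ H \<le> K * ((n + 1) * g) ^ H" by (rule mult_left_mono) simp
    moreover have "1 \<le> ((n + 1) * g) ^ H" using \<open>1 \<le> g\<close> by simp
    ultimately have "T \<le> K * ((n + 1) * g) ^ H + 2 * ((n + 1) * g) ^ H"
      using T(2) KH[of B] by linarith
    also have "\<dots> = (K + 2) * g ^ H * (n + 1) ^ H"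
      unfolding power_mult_distrib by (simp only: distrib_right distrib_left ac_simps)
    also have "\<dots> = f k ?t * poly ([:1, 1:] ^ H) n"
      by (simp add: f g_def add.commute)
    finally show ?thesis using T(1) T(3)[unfolded ev_mainE] by blast
  qed
  ultimately show ?thesis by blast
qed

end
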